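(* Let $d$ and $m$ be positive integers. A rank $d$ positroid on the ground set $[d+m]$ is a rational Dyck positroid if and only if it can be represented by one of the plabic graphs $G_{\mathsf{d}}$, where $\mathsf{d}$ is a rational Dyck path of type $(m,d)$.
   Context: $[n]=\{1,\dots,n\}$. A rational Dyck path of type $(m,d)$ is a lattice path from $(0,0)$ to $(m,d)$ that only uses unit steps $(1,0)$ or $(0,1)$ and never goes above the line $y=(d/m)x$. A $d\times m$ binary matrix $(a_{i,j})$ is a rational Dyck matrix if its zero entries are separated from its one entries by a vertically-reflected rational Dyck path of type $(m,d)$, with the zeros in the upper-right corner; explicitly, there is a rational Dyck path of type $(m,d)$ such that, if $h_j$ is the height ($y$-coordinate) of its $j$-th horizontal step from the left, then $a_{i,j}=0$ if and only if $i\le h_j$. $\mathcal{D}_{d,m}$ denotes the set of all $d\times m$ rational Dyck matrices. The map $\phi_{d,m}\colon \mathrm{Mat}_{d,m}(\mathbb{R})\to \mathrm{Mat}_{d,d+m}(\mathbb{R})$ sends $A=(a_{i,j})$ to the block matrix $(I_d \mid A')$, where $A'$ is the $d\times m$ matrix with $(i,j)$ entry $(-1)^{d-i}a_{d+1-i,j}$. A positroid of rank $d$ on $[n]$ is a matroid represented by a full-rank real $d\times n$ matrix $A$ with nonnegative maximal minors: its bases are the $B\subseteq[n]$ such that the columns of $A$ indexed by $B$ form a basis of $\mathbb{R}^d$. Matrices in $\phi_{d,m}(\mathcal{D}_{d,m})$ have full rank and nonnegative maximal minors; a rank $d$ rational Dyck positroid on $[d+m]$ is a positroid represented by a matrix in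 $\phi_{d,m}(\mathcal{D}_{d,m})$. A plabic graph is an undirected graph $G$ drawn inside a disk (up to homotopy) with finitely many vertices on the boundary of the disk (boundary vertices, labeled clockwise $1,\dots,n$), each incident to a single edge; the remaining (internal) vertices lie strictly inside the disk and are colored black or white. A perfect orientation $\mathcal{O}$ of $G$ is a choice of directions of all edges such that each black vertex has outdegree one and each white vertex has indegree one; its source set $I_{\mathcal{O}}$ is the set of boundary vertices of indegree zero. A perfectly orientable plabic graph $G$ with $n$ boundary vertices represents the positroid $P_G=([n],\mathcal{B}_G)$ with $\mathcal{B}_G=\{I_{\mathcal{O}}\mid \mathcal{O}\text{ a perfect orientation of }G\}$. For a rational Dyck path $\mathsf{d}$ of type $(m,d)$, the plabic graph $G_{\mathsf{d}}$ is constructed as follows. (1) Draw a circle with $(0,0)$ and $(m,d)$ diametrically opposed, and draw a black (resp., white) vertex in the middle of each vertical (resp., horizontal) step of $\mathsf{d}$. (2) Draw a horizontal segment from each black vertex to the circle (going east) and label the intersections by $1,\dots,d$ clockwise (i.e. from top to bottom); draw a vertical segment from each white vertex to the circle (going north) and label the intersections by $d+1,\dots,d+m$ clockwise (i.e. from left to right). (3) Join consecutive internal vertices along $\mathsf{d}$ by segments, and discard $\mathsf{d}$ itself. The boundary vertices are the labeled points on the circle, and the edges are the segments drawn. *)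

theory Defs
  imports
    "HOL-Analysis.Path_Connected"
    "Jordan_Normal_Form.DL_Rank"
    "Jordan_Normal_Form.DL_Submatrix"
begin

section \<open>Rational Dyck paths\<close>

datatype step = East | North

text \<open>A lattice path starting at the origin is its list of unit steps.\<close>

definition lattice_point :: "step list \<Rightarrow> nat \<Rightarrow> nat \<times> nat" where
  "lattice_point p k = (count_list (take k p) East, count_list (take k p) North)"

text \<open>A unit-step path is below a line as soon as its lattice points are.\<close>

definition rational_dyck_path :: "nat \<Rightarrow> nat \<Rightarrow> step list \<Rightarrow> bool" where
  "rational_dyck_path m d p \<longleftrightarrow>
     lattice_point p (length p) = (m, d) \<and>
     (\<forall>k \<le> length p. case lattice_point p k of (x, y) \<Rightarrow>
        real y \<le> real d / real m * real x)"

text \<open>The position in \<open>p\<close> of the \<open>j\<close>-th step of kind \<open>s\<close>; steps of each kind are counted from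
  \<open>1\<close> along the path, that is, from left to right for \<open>East\<close> and from bottom to top for
  \<open>North\<close>, whereas positions in \<open>p\<close> start at \<open>0\<close>.\<close>

definition step_pos :: "step list \<Rightarrow> step \<Rightarrow> nat \<Rightarrow> nat" where
  "step_pos p s j = filter (\<lambda>k. p ! k = s) [0..<length p] ! (j - 1)"

definition east_height :: "step list \<Rightarrow> nat \<Rightarrow> nat" where
  "east_height p j = snd (lattice_point p (step_pos p East j))"

section \<open>Rational Dyck matrices and positroids\<close>

text \<open>Row, column and ground set labels start at \<open>1\<close>; the entries of a library matrix are
  addressed from \<open>0\<close>.\<close>

definition rational_dyck_matrices :: "nat \<Rightarrow> nat \<Rightarrow> real mat set" where
  "rational_dyck_matrices d m =
     {A \<in> carrier_mat d m.
        (\<forall>i\<in>{1..d}. \<forall>j\<in>{1..m}. A $$ (i - 1, j - 1) \<in> {0, 1}) \<and>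
        (\<exists>p. rational_dyck_path m d p \<and>
           (\<forall>i\<in>{1..d}. \<forall>j\<in>{1..m}. A $$ (i - 1, j - 1) = 0 \<longleftrightarrow> i \<le> east_height p j))}"

text \<open>With \<open>i\<close> the row label, the library row index is \<open>i - 1\<close>, hence the exponent \<open>d - i\<close> and the
  row \<open>d + 1 - i\<close> become \<open>d - 1 - (i - 1)\<close>.\<close>

definition phi :: "nat \<Rightarrow> nat \<Rightarrow> real mat \<Rightarrow> real mat" where
  "phi d m A = mat d (d + m) (\<lambda>(i, j).
     if j < d then (if i = j then 1 else 0)
     else (-1) ^ (d - 1 - i) * A $$ (d - 1 - i, j - d))"

text \<open>A matroid is given by its ground set and its set of bases.\<close>

type_synonym matroid = "nat set \<times> nat set set"

text \<open>Injectivity is needed because repeated columns are collapsed in the image.\<close>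

definition columns_form_basis :: "nat \<Rightarrow> real mat \<Rightarrow> nat set \<Rightarrow> bool" where
  "columns_form_basis d A B \<longleftrightarrow>
     inj_on (\<lambda>j. col A (j - 1)) B \<and>
     vectorspace.basis class_ring (module_vec TYPE(real) d) ((\<lambda>j. col A (j - 1)) ` B)"

definition column_matroid :: "nat \<Rightarrow> nat \<Rightarrow> real mat \<Rightarrow> matroid" where
  "column_matroid d n A = ({1..n}, {B. B \<subseteq> {1..n} \<and> columns_form_basis d A B})"

definition positroid :: "nat \<Rightarrow> nat \<Rightarrow> matroid \<Rightarrow> bool" where
  "positroid d n P \<longleftrightarrow>
     (\<exists>A \<in> carrier_mat d n.
        vec_space.rank d A = d \<and>
        (\<forall>J. J \<subseteq> {..<n} \<and> card J = d \<longrightarrow> det (submatrix A UNIV J) \<ge> 0) \<and>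
        P = column_matroid d n A)"

definition rational_dyck_positroid :: "nat \<Rightarrow> nat \<Rightarrow> matroid \<Rightarrow> bool" where
  "rational_dyck_positroid d m P \<longleftrightarrow>
     positroid d (d + m) P \<and>
     (\<exists>A \<in> phi d m ` rational_dyck_matrices d m. P = column_matroid d (d + m) A)"

section \<open>Plabic graphs\<close>

text \<open>A plabic graph is given by a drawing in a closed disk of the complex plane. An undirected edge
  is stored as a curve with an arbitrarily chosen direction of traversal; parallel edges and loops
  are allowed. The label \<open>i\<close> of a boundary vertex ranges over \<open>{1..bdry_count G}\<close>, and
  \<open>bdry G\<close> is meaningless elsewhere.\<close>

record plabic =
  disk_centre :: complex
  disk_radius :: real
  bdry_count :: nat
  bdry :: "nat \<Rightarrow> complex"
  black :: "complex set"
  white :: "complex set"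
  edges :: "(real \<Rightarrow> complex) set"

definition verts :: "plabic \<Rightarrow> complex set" where
  "verts G = bdry G ` {1..bdry_count G} \<union> black G \<union> white G"

text \<open>The condition on the angles \<open>\<theta>\<close> says that the labels increase clockwise and that they
  go around the circle at most once.\<close>

definition plabic_graph :: "plabic \<Rightarrow> bool" where
  "plabic_graph G \<longleftrightarrow>
     disk_radius G > 0 \<and>
     (\<exists>\<theta> :: nat \<Rightarrow> real.
        (\<forall>i\<in>{1..bdry_count G}.
           bdry G i = disk_centre G + of_real (disk_radius G) * cis (\<theta> i)) \<and>
        (\<forall>i\<in>{1..bdry_count G}. \<forall>j\<in>{1..bdry_count G}.
           i < j \<longrightarrow> \<theta> j < \<theta> i \<and> \<theta> i < \<theta> j + 2 * pi)) \<and>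
     finite (black G) \<and> finite (white G) \<and> black G \<inter> white G = {} \<and>
     black G \<union> white G \<subseteq> ball (disk_centre G) (disk_radius G) \<and>
     finite (edges G) \<and>
     (\<forall>e\<in>edges G. simple_path e \<and> pathstart e \<in> verts G \<and> pathfinish e \<in> verts G \<and>
        e ` {0<..<1} \<subseteq> ball (disk_centre G) (disk_radius G) - verts G) \<and>
     (\<forall>e\<in>edges G. \<forall>e'\<in>edges G. e \<noteq> e' \<longrightarrow> e ` {0<..<1} \<inter> e' ` {0<..<1} = {}) \<and>
     (\<forall>v \<in> bdry G ` {1..bdry_count G}.
        card {e \<in> edges G. pathstart e = v} + card {e \<in> edges G. pathfinish e = v} = 1)"

text \<open>An orientation assigns to every edge the pair (tail, head).\<close>

type_synonym orientation = "(real \<Rightarrow> complex) \<Rightarrow> complex \<times> complex"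

definition is_orientation :: "plabic \<Rightarrow> orientation \<Rightarrow> bool" where
  "is_orientation G \<omega> \<longleftrightarrow>
     (\<forall>e\<in>edges G. \<omega> e \<in> {(pathstart e, pathfinish e), (pathfinish e, pathstart e)})"

definition indeg :: "plabic \<Rightarrow> orientation \<Rightarrow> complex \<Rightarrow> nat" where
  "indeg G \<omega> v = card {e \<in> edges G. snd (\<omega> e) = v}"

definition outdeg :: "plabic \<Rightarrow> orientation \<Rightarrow> complex \<Rightarrow> nat" where
  "outdeg G \<omega> v = card {e \<in> edges G. fst (\<omega> e) = v}"

definition perfect_orientation :: "plabic \<Rightarrow> orientation \<Rightarrow> bool" where
  "perfect_orientation G \<omega> \<longleftrightarrow>
     is_orientation G \<omega> \<and>
     (\<forall>v\<in>black G. outdeg G \<omega> v = 1) \<and> (\<forall>v\<in>white G. indeg G \<omega> v = 1)"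

definition source_set :: "plabic \<Rightarrow> orientation \<Rightarrow> nat set" where
  "source_set G \<omega> = {i \<in> {1..bdry_count G}. indeg G \<omega> (bdry G i) = 0}"

definition plabic_matroid :: "plabic \<Rightarrow> matroid" where
  "plabic_matroid G =
     ({1..bdry_count G}, {source_set G \<omega> |\<omega>. perfect_orientation G \<omega>})"

definition plabic_represents :: "plabic \<Rightarrow> matroid \<Rightarrow> bool" where
  "plabic_represents G P \<longleftrightarrow>
     plabic_graph G \<and> (\<exists>\<omega>. perfect_orientation G \<omega>) \<and> P = plabic_matroid G"

section \<open>The plabic graph of a rational Dyck path\<close>

definition step_mid :: "step list \<Rightarrow> nat \<Rightarrow> complex" where
  "step_mid p k = midpoint
     (case lattice_point p k of (x, y) \<Rightarrow> Complex (real x) (real y))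
     (case lattice_point p (Suc k) of (x, y) \<Rightarrow> Complex (real x) (real y))"

text \<open>Where the horizontal ray going east, respectively the vertical ray going north, from a point
  \<open>v\<close> inside the circle with centre \<open>c\<close> and radius \<open>r\<close> meets the circle.\<close>

definition east_point :: "complex \<Rightarrow> real \<Rightarrow> complex \<Rightarrow> complex" where
  "east_point c r v = Complex (Re c + sqrt (r\<^sup>2 - (Im v - Im c)\<^sup>2)) (Im v)"

definition north_point :: "complex \<Rightarrow> real \<Rightarrow> complex \<Rightarrow> complex" where
  "north_point c r v = Complex (Re v) (Im c + sqrt (r\<^sup>2 - (Re v - Re c)\<^sup>2))"

text \<open>The labels \<open>1, ..., d\<close> run from top to bottom, so label \<open>i\<close> belongs to the
  \<open>(d + 1 - i)\<close>-th vertical step along the path.\<close>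

definition dyck_plabic :: "nat \<Rightarrow> nat \<Rightarrow> step list \<Rightarrow> plabic" where
  "dyck_plabic m d p =
     (let c = midpoint 0 (Complex (real m) (real d));
          r = cmod (Complex (real m) (real d)) / 2;
          B = step_mid p ` {k. k < length p \<and> p ! k = North};
          W = step_mid p ` {k. k < length p \<and> p ! k = East}
      in \<lparr> disk_centre = c,
           disk_radius = r,
           bdry_count = d + m,
           bdry = (\<lambda>i. if i \<le> d then east_point c r (step_mid p (step_pos p North (d + 1 - i)))
                       else north_point c r (step_mid p (step_pos p East (i - d)))),
           black = B,
           white = W,
           edges = (\<lambda>v. linepath v (east_point c r v)) ` B
                 \<union> (\<lambda>v. linepath v (north_point c r v)) ` W
                 \<union> (\<lambda>k. linepath (step_mid p k) (step_mid p (Suc k))) ` {k. Suc k < length p} \<rparr>)"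

end

theory Submission
  imports Defs
begin

text \<open>Number the steps of a rational Dyck path \<open>p\<close> from its start. Every step carries one element of the
ground set: its \<open>label\<close> indexes a column of the matrix \<open>\<phi>(A)\<close> of the path, and also the boundary vertex
that the construction of the plabic graph attaches to the step. A set of labels is thus a set \<open>K\<close> of
steps, and the theorem follows because both matroids have as bases exactly the same sets \<open>K\<close>: those
for which the East steps in \<open>K\<close> and the North steps outside \<open>K\<close> alternate along the path, starting with
an East step and ending with a North step. This is encoded as a \<open>switching_walk\<close>, a bit that is carried
along the path, is switched on by the East steps in \<open>K\<close>, is switched off by the North steps outside \<open>K\<close>,
and is off at both ends; no switch may be idle.

For the matrix, reverse the order of the rows, so that they correspond to the North steps in path order.
Up to a sign for each row, the column of a North step is the unit vector of its row and the column of
an East step is the sum of the unit vectors of all later North steps. The coefficients of a linear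
relation between the columns in \<open>K\<close> therefore define a \<open>current\<close> along the path, which starts at zero,
changes only at East steps in \<open>K\<close>, and must vanish at the North steps outside \<open>K\<close>; at the North steps in
\<open>K\<close> it determines the coefficient. If a switching walk exists, each current vanishes
(\<open>switching_walk_independent\<close>). Conversely, if an East step in \<open>K\<close> is not followed by a North step
outside \<open>K\<close> before the next East step in \<open>K\<close> or before the end, then a unit current can flow in between,
and \<open>K\<close> is dependent (\<open>independent_steps_gap\<close>). A basis has as many elements as there are North steps,
so it has equally many East steps inside and North steps outside, and this forces the alternation
(\<open>independent_steps_switching_walk\<close>).

For the plabic graph, the internal vertices form a chain in path order, each with one further edge to
the boundary. The bit of the walk is the direction of the chain edges: on means along the path, off
means backwards. The conditions on the outdegree of black and the indegree of white vertices
say that the bit behaves as prescribed, where \<open>K\<close> consists of the steps whose boundary vertex is a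
source (\<open>perfect_iff_switching_walk\<close>).

The drawing is a plabic graph since the midpoints of the steps move weakly to the right and upwards and
the sum of their coordinates grows by one at every step, which separates the segments from each other,
and since the corners \<open>(0,0)\<close> and \<open>(m,d)\<close> are antipodal, so that the eastern and the northern end points
occupy disjoint arcs.\<close>

section \<open>Bases among the columns of a matrix\<close>

text \<open>In dimension \<open>d\<close> an independent family of \<open>d\<close> vectors spans, so that only relations have to be studied.
Indexing the coefficients by column numbers rather than by vectors absorbs the injectivity condition:
two equal columns give a relation with coefficients \<open>1\<close> and \<open>-1\<close>.\<close>

lemma columns_form_basis_iff:
  fixes A :: "real mat"
  assumes A: "A \<in> carrier_mat d n" and B: "B \<subseteq> {1..n}"
  shows "columns_form_basis d A B \<longleftrightarrow>
    card B = d \<and>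
    (\<forall>c. (\<forall>i<d. (\<Sum>b\<in>B. c b * A $$ (i, b - 1)) = 0) \<longrightarrow> (\<forall>b\<in>B. c b = 0))"
    (is "_ \<longleftrightarrow> _ \<and> ?ker")
proof -
  interpret vec_space "TYPE(real)" d .
  define f where "f = (\<lambda>b. col A (b - 1))"
  have finB: "finite B" using B finite_subset by blast
  have fC: "f ` B \<subseteq> carrier_vec d" using A by (auto simp: f_def)
  have entry: "f b $ i = A $$ (i, b - 1)" if "b \<in> B" "i < d" for b i
  proof -
    have "b - 1 < n" using B that by force
    then show ?thesis using A that by (auto simp: f_def)
  qed
  have comb: "lincomb a (f ` B) = 0\<^sub>v d \<longleftrightarrow> (\<forall>i<d. (\<Sum>b\<in>B. a (f b) * A $$ (i, b - 1)) = 0)"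
    if inj: "inj_on f B" for a
  proof -
    have dim: "dim_vec (lincomb a (f ` B)) = d" using fC finB by (simp add: lincomb_dim)
    have idx: "lincomb a (f ` B) $ i = (\<Sum>b\<in>B. a (f b) * A $$ (i, b - 1))" if "i < d" for i
    proof -
      have "lincomb a (f ` B) $ i = (\<Sum>x\<in>f ` B. a x * x $ i)"
        by (rule lincomb_index[OF that fC])
      also have "\<dots> = (\<Sum>b\<in>B. a (f b) * f b $ i)"
        by (simp add: sum.reindex[OF inj])
      also have "\<dots> = (\<Sum>b\<in>B. a (f b) * A $$ (i, b - 1))"
        using entry that by (intro sum.cong) auto
      finally show ?thesis .
    qed
    show ?thesis using dim idx by (auto simp: vec_eq_iff)
  qed
  have cfb: "columns_form_basis d A B \<longleftrightarrow> inj_on f B \<and> basis (f ` B)"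
    by (simp add: columns_form_basis_def f_def)
  show ?thesis
  proof
    assume "columns_form_basis d A B"
    then have inj: "inj_on f B" and bas: "basis (f ` B)" using cfb by auto
    have "card B = card (f ` B)" using inj by (simp add: card_image)
    also have "\<dots> = d" using dim_basis[OF _ bas] finB dim_is_n by simp
    finally have card: "card B = d" .
    have li: "lin_indpt (f ` B)" using bas by (simp add: basis_def)
    have ?ker
    proof (intro allI impI ballI)
      fix c b assume c: "\<forall>i<d. (\<Sum>b\<in>B. c b * A $$ (i, b - 1)) = 0" and b: "b \<in> B"
      let ?a = "\<lambda>v. c (the_inv_into B f v)"
      have "lincomb ?a (f ` B) = 0\<^sub>v d"
        unfolding comb[OF inj] using c inj by (simp add: the_inv_into_f_f)
      then have "?a \<in> f ` B \<rightarrow> {0}"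
        using not_lindepD[OF li _ subset_refl, of ?a] finB by (auto simp: class_ring_simps)
      then show "c b = 0" using b inj by (force simp: the_inv_into_f_f)
    qed
    with card show "card B = d \<and> ?ker" by blast
  next
    assume r: "card B = d \<and> ?ker"
    then have card: "card B = d" and ker: ?ker by blast+
    have inj: "inj_on f B"
    proof (rule inj_onI, rule ccontr)
      fix x y assume xy: "x \<in> B" "y \<in> B" "f x = f y" "x \<noteq> y"
      let ?c = "\<lambda>b. if b = x then 1 else if b = y then -1 else (0::real)"
      have "(\<Sum>b\<in>B. ?c b * A $$ (i, b - 1)) = 0" if "i < d" for i
      proof -
        have "(\<Sum>b\<in>B. ?c b * A $$ (i, b - 1)) = (\<Sum>b\<in>{x,y}. ?c b * A $$ (i, b - 1))"
          using finB xy by (intro sum.mono_neutral_right) auto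
        also have "\<dots> = f x $ i - f y $ i"
          unfolding entry[OF xy(1) that] entry[OF xy(2) that] using xy(4) by simp
        finally show ?thesis using xy by simp
      qed
      then have "\<forall>b\<in>B. ?c b = 0" using ker[rule_format, of ?c] by blast
      then show False using xy(1) by force
    qed
    have li: "lin_indpt (f ` B)"
    proof
      assume "lin_dep (f ` B)"
      then obtain a v where a: "lincomb a (f ` B) = 0\<^sub>v d" and v: "v \<in> f ` B" "a v \<noteq> 0"
        using finite_lin_dep[of "f ` B"] finB fC by (auto simp: class_ring_simps)
      then show False using ker comb[OF inj] by auto
    qed
    have "basis (f ` B)"
      using dim_li_is_basis[OF fin_dim _ _ li] finB fC card inj by (simp add: dim_is_n card_image)
    then show "columns_form_basis d A B" using cfb inj by blast
  qed
qed

section \<open>Steps of a lattice path\<close>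

definition steps_before :: "step list \<Rightarrow> step \<Rightarrow> nat \<Rightarrow> nat" where
  "steps_before p s k = count_list (take k p) s"

lemma lattice_point_eq: "lattice_point p k = (steps_before p East k, steps_before p North k)"
  by (simp add: lattice_point_def steps_before_def)

lemma steps_before_0 [simp]: "steps_before p s 0 = 0"
  by (simp add: steps_before_def)

lemma steps_before_Suc:
  "k < length p \<Longrightarrow> steps_before p s (Suc k) = steps_before p s k + (if p ! k = s then 1 else 0)"
  by (simp add: steps_before_def take_Suc_conv_app_nth)

lemma steps_before_mono: "j \<le> k \<Longrightarrow> steps_before p s j \<le> steps_before p s k"
  by (auto simp: steps_before_def le_iff_add take_add)

lemma steps_before_less:
  assumes "j < k" "j < length p" "p ! j = s"
  shows "steps_before p s j < steps_before p s k"
  using steps_before_mono[of "Suc j" k p s] assms by (simp add: steps_before_Suc)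

lemma step_neq_iff [simp]: "s \<noteq> East \<longleftrightarrow> s = North" "s \<noteq> North \<longleftrightarrow> s = East"
  by (cases s; simp)+

lemma steps_before_sum: "k \<le> length p \<Longrightarrow> steps_before p East k + steps_before p North k = k"
  by (induction k) (auto simp: steps_before_Suc)

lemma steps_before_length: "steps_before p s (length p) = count_list p s"
  by (simp add: steps_before_def)

text \<open>Appending a step to a path appends its position to the list of positions of that kind of step.\<close>

lemma step_pos_props:
  assumes "1 \<le> i" "i \<le> count_list p s"
  shows "step_pos p s i < length p \<and> p ! step_pos p s i = s \<and> steps_before p s (step_pos p s i) = i - 1"
  using assms
proof (induction p rule: rev_induct)
  case Nil
  then show ?case by simp
next
  case (snoc a p)
  let ?L = "\<lambda>p. filter (\<lambda>k. p ! k = s) [0..<length p]"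
  have len: "length (?L q) = count_list q s" for q
  proof -
    have "count_list q s = length (filter (\<lambda>a. a = s) (map ((!) q) [0..<length q]))"
    proof -
      have "(=) s = (\<lambda>a. a = s)" by auto
      then show ?thesis by (simp only: count_list_eq_length_filter map_nth)
    qed
    then show ?thesis by (simp only: length_filter_map o_def)
  qed
  have app: "?L (p @ [a]) = ?L p @ (if a = s then [length p] else [])"
    by (auto simp: nth_append intro!: filter_cong)
  have pos: "step_pos (p @ [a]) s i = (?L p @ (if a = s then [length p] else [])) ! (i - 1)"
    by (simp only: step_pos_def app)
  show ?case
  proof (cases "i \<le> count_list p s")
    case True
    then have "step_pos (p @ [a]) s i = step_pos p s i"
      using snoc.prems pos by (auto simp: step_pos_def nth_append len)
    with snoc.IH True snoc.prems show ?thesis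
      by (auto simp: nth_append steps_before_def)
  next
    case False
    then have "a = s" "i = Suc (count_list p s)" using snoc.prems by (auto split: if_splits)
    moreover from this have "step_pos (p @ [a]) s i = length p"
      using pos by (simp add: nth_append len)
    ultimately show ?thesis by (auto simp: steps_before_def)
  qed
qed

lemma step_pos_unique:
  assumes "k < length p" "p ! k = s"
  shows "step_pos p s (Suc (steps_before p s k)) = k"
proof -
  let ?k = "step_pos p s (Suc (steps_before p s k))"
  have "steps_before p s k < count_list p s"
    using steps_before_less[OF assms(1) assms] by (simp add: steps_before_length)
  then have "?k < length p" "p ! ?k = s" "steps_before p s ?k = steps_before p s k"
    using step_pos_props[of "Suc (steps_before p s k)" p s] by auto
  then show ?thesis
    using steps_before_less[of k ?k p s] steps_before_less[of ?k k p s] assms by (metis nat_neq_iff)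
qed

lemma step_with_count:
  assumes "t < count_list p s"
  obtains k where "k < length p" "p ! k = s" "steps_before p s k = t"
  using step_pos_props[of "Suc t" p s] assms by auto

section \<open>Switching walks and linear relations between steps\<close>

text \<open>The bit \<open>s k\<close> is the state just before step \<open>k\<close>. The condition \<open>(p ! k = East) = (k \<in> K)\<close> picks out the steps
that switch, namely the East steps in \<open>K\<close> and the North steps outside \<open>K\<close>.\<close>

definition switching_walk :: "step list \<Rightarrow> nat set \<Rightarrow> (nat \<Rightarrow> bool) \<Rightarrow> bool" where
  "switching_walk p K s \<longleftrightarrow> \<not> s 0 \<and> \<not> s (length p) \<and>
     (\<forall>k<length p. if (p ! k = East) = (k \<in> K) then s k = (p ! k = North) \<and> s (Suc k) = (p ! k = East)
                   else s (Suc k) = s k)"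

text \<open>The bit being off at both ends, there are as many East steps in \<open>K\<close> as North steps outside \<open>K\<close>; on an
initial part of the path the difference of the two numbers is the bit.\<close>

lemma switching_walk_card:
  assumes "switching_walk p K s" "K \<subseteq> {..<length p}"
  shows "card K = count_list p North"
proof -
  have *: "int (card (K \<inter> {..<k})) = int (steps_before p North k) + of_bool (s k)" if "k \<le> length p" for k
    using that
  proof (induction k)
    case 0
    then show ?case using assms by (simp add: switching_walk_def)
  next
    case (Suc k)
    have "K \<inter> {..<Suc k} = (if k \<in> K then insert k (K \<inter> {..<k}) else K \<inter> {..<k})"
      by (auto simp: lessThan_Suc)
    then show ?case
      using Suc assms(1) unfolding switching_walk_def
      by (cases "p ! k") (auto simp: steps_before_Suc split: if_splits)
  qed
  from *[of "length p"] assms show ?thesis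
    by (auto simp: switching_walk_def steps_before_length Int_absorb2)
qed

text \<open>The net amount that the coefficients \<open>c\<close> of the East steps in \<open>K\<close> have injected before step \<open>q\<close>.\<close>

definition current :: "step list \<Rightarrow> nat set \<Rightarrow> (nat \<Rightarrow> real) \<Rightarrow> nat \<Rightarrow> real" where
  "current p K c q = (\<Sum>k<q. if k \<in> K \<and> p ! k = East then c k else 0)"

text \<open>Independence of the columns of \<open>\<phi>(A)\<close> that belong to the steps in \<open>K\<close>, with one equation for
every row, that is, for every North step; \<open>\<epsilon>\<close> collects the signs of the rows.\<close>

definition independent_steps :: "step list \<Rightarrow> (nat \<Rightarrow> real) \<Rightarrow> nat set \<Rightarrow> bool" where
  "independent_steps p \<epsilon> K \<longleftrightarrow>
     (\<forall>c. (\<forall>q<length p. p ! q = North \<longrightarrow> (if q \<in> K then c q else 0) + \<epsilon> q * current p K c q = 0)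
        \<longrightarrow> (\<forall>k\<in>K. c k = 0))"

text \<open>At a North step outside \<open>K\<close> the current is zero, and it changes only when the bit is switched on.
Hence it is zero while the bit is on, by going backwards from the next North step outside \<open>K\<close>, and
zero while the bit is off, by going forwards from the previous one or from the start.
A coefficient is either a difference of currents or proportional to a current.\<close>

lemma switching_walk_independent:
  assumes walk: "switching_walk p K s" and K: "K \<subseteq> {..<length p}"
    and eps: "\<And>q. q < length p \<Longrightarrow> \<epsilon> q \<noteq> 0"
  shows "independent_steps p \<epsilon> K"
  unfolding independent_steps_def
proof (intro allI impI ballI)
  fix c k
  let ?S = "current p K c"
  assume c: "\<forall>q<length p. p ! q = North \<longrightarrow> (if q \<in> K then c q else 0) + \<epsilon> q * ?S q = 0"
    and k: "k \<in> K"
  have Suc: "?S (Suc q) = ?S q + (if q \<in> K \<and> p ! q = East then c q else 0)" for q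
    by (simp add: current_def)
  have stp: "if (p ! q = East) = (q \<in> K) then s q = (p ! q = North) \<and> s (Suc q) = (p ! q = East)
      else s (Suc q) = s q" if "q < length p" for q
    using walk that by (auto simp: switching_walk_def)
  have north: "?S q = 0" if "q < length p" "p ! q = North" "q \<notin> K" for q
    using c that eps[of q] by auto
  have R: "s q \<longrightarrow> ?S q = 0" if "q \<le> length p" for q
    using that
  proof (induction q rule: inc_induct)
    case base
    then show ?case using walk by (auto simp: switching_walk_def)
  next
    case (step q)
    then show ?case using stp[of q] north[of q] Suc[of q]
      by (cases "p ! q") (auto split: if_splits)
  qed
  have L: "\<not> s q \<longrightarrow> ?S q = 0" if "q \<le> length p" for q
    using that
  proof (induction q)
    case 0
    then show ?case by (simp add: current_def)
  next
    case (Suc q)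
    then show ?case using stp[of q] north[of q] \<open>?S (Suc q) = _\<close>
      by (cases "p ! q") (auto split: if_splits)
  qed
  have S: "?S q = 0" if "q \<le> length p" for q using L R that by blast
  have "k < length p" using k K by auto
  then show "c k = 0"
    using S[of k] S[of "Suc k"] Suc[of k] c k by (cases "p ! k") auto
qed

text \<open>Otherwise a unit current can be injected at an East step in \<open>K\<close> and either be extracted at the next one
or flow on to the end, without meeting a row that forces it to vanish.\<close>

lemma independent_steps_gap:
  assumes ind: "independent_steps p \<epsilon> K" and K: "K \<subseteq> {..<length p}"
    and l: "l < y" "l \<in> K" "p ! l = East" and y: "y = length p \<or> y < length p \<and> y \<in> K \<and> p ! y = East"
  shows "\<exists>k. l < k \<and> k < y \<and> p ! k = North \<and> k \<notin> K"
proof (rule ccontr)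
  assume none: "\<not> ?thesis"
  define x where "x = Max {x. x < y \<and> x \<in> K \<and> p ! x = East}"
  have fin: "finite {x. x < y \<and> x \<in> K \<and> p ! x = East}" by simp
  have "l \<in> {x. x < y \<and> x \<in> K \<and> p ! x = East}" using l by simp
  then have "x \<in> {x. x < y \<and> x \<in> K \<and> p ! x = East}" "l \<le> x"
    using Max_in[OF fin] Max_ge[OF fin] unfolding x_def by blast+
  then have x: "x < y" "x \<in> K" "p ! x = East" "l \<le> x" by auto
  have last: "\<not> (k \<in> K \<and> p ! k = East)" if "x < k" "k < y" for k
  proof -
    have "k \<notin> {x. x < y \<and> x \<in> K \<and> p ! x = East}"
      using Max_ge[OF fin, of k] that(1) unfolding x_def by (meson not_le)
    then show ?thesis using that(2) by blast
  qed
  \<comment> \<open>The unit current that flows from the last East step in \<open>K\<close> before \<open>y\<close> up to \<open>y\<close>.\<close>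
  define S :: "nat \<Rightarrow> real" where "S k = of_bool (x < k \<and> k \<le> y)" for k
  define c where "c k = (if p ! k = East then S (Suc k) - S k else - \<epsilon> k * S k)" for k
  have jump: "S (Suc k) = S k" if "\<not> (k \<in> K \<and> p ! k = East)" "k < length p" for k
  proof -
    have "k \<noteq> x" "k \<noteq> y" using that x y by auto
    then show ?thesis by (auto simp: S_def)
  qed
  have cur: "current p K c k = S k" if "k \<le> length p" for k
    using that
  proof (induction k)
    case 0
    then show ?case by (simp add: current_def S_def)
  next
    case (Suc k)
    then show ?case using jump[of k] by (auto simp: current_def c_def)
  qed
  have "\<forall>q<length p. p ! q = North \<longrightarrow> (if q \<in> K then c q else 0) + \<epsilon> q * current p K c q = 0"
  proof (intro allI impI)
    fix q assume q: "q < length p" "p ! q = North"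
    show "(if q \<in> K then c q else 0) + \<epsilon> q * current p K c q = 0"
    proof (cases "q \<in> K")
      case True
      then show ?thesis using q cur[of q] by (simp add: c_def)
    next
      case False
      have "S q = 0"
      proof (rule ccontr)
        assume "S q \<noteq> 0"
        then have "x < q" "q \<le> y" by (auto simp: S_def split: if_splits)
        moreover have "q \<noteq> y" using y q by auto
        ultimately have "l < q" "q < y" using x(4) by auto
        then show False using none q False by blast
      qed
      then show ?thesis using False cur[of q] q by simp
    qed
  qed
  then have "c x = 0" using ind x by (auto simp: independent_steps_def)
  moreover have "c x = 1" using x by (simp add: c_def S_def)
  ultimately show False by simp
qed

text \<open>Let the bit record whether the last switching step was an East step in \<open>K\<close>. By
\<open>independent_steps_gap\<close> no East step in \<open>K\<close> finds the bit on, and the bit is off at the end. Since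
\<open>K\<close> has as many East steps as it misses North steps, no missed North step can find the bit already off.\<close>

lemma independent_steps_switching_walk:
  assumes ind: "independent_steps p \<epsilon> K" and K: "K \<subseteq> {..<length p}"
    and card: "card K = count_list p North"
  shows "\<exists>s. switching_walk p K s"
proof -
  define s where "s k \<longleftrightarrow> (\<exists>l<k. l \<in> K \<and> p ! l = East \<and> (\<forall>j. l < j \<and> j < k \<longrightarrow> \<not> (p ! j = North \<and> j \<notin> K)))"
    for k
  have s0: "\<not> s 0" by (simp add: s_def)
  have gap: "\<not> s y" if "y = length p \<or> y < length p \<and> y \<in> K \<and> p ! y = East" for y
    using independent_steps_gap[OF ind K _ _ _ that] unfolding s_def by meson
  have sn: "\<not> s (length p)" using gap by blast
  have s_on: "s (Suc k)" if "k \<in> K" "p ! k = East" for k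
    using that by (auto simp: s_def)
  have s_off: "\<not> s (Suc k)" if "k \<notin> K" "p ! k = North" for k
    unfolding s_def using that by (auto simp: less_Suc_eq)
  have s_keep: "s (Suc k) = s k" if "(p ! k = East) \<noteq> (k \<in> K)" for k
    unfolding s_def using that by (auto simp: less_Suc_eq)
  have s_before: "\<not> s k" if "k \<in> K" "p ! k = East" for k
    using gap[of k] that K by auto
  \<comment> \<open>The North steps that would switch the bit off although it is off already.\<close>
  let ?bad = "\<lambda>k. {q. q < k \<and> q \<notin> K \<and> p ! q = North \<and> \<not> s q}"
  have "int (card (K \<inter> {..<k})) = int (steps_before p North k) + of_bool (s k) - int (card (?bad k))"
    if "k \<le> length p" for k
    using that
  proof (induction k)
    case 0
    then show ?case using s0 by simp
  next
    case (Suc k)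
    have 1: "K \<inter> {..<Suc k} = (if k \<in> K then insert k (K \<inter> {..<k}) else K \<inter> {..<k})"
      by (auto simp: lessThan_Suc)
    have 2: "?bad (Suc k) = (if k \<notin> K \<and> p ! k = North \<and> \<not> s k then insert k (?bad k) else ?bad k)"
      by (auto simp: less_Suc_eq)
    show ?case
      using Suc s_on[of k] s_off[of k] s_keep[of k] s_before[of k]
      unfolding 1 2 by (cases "p ! k"; cases "k \<in> K"; cases "s k") (auto simp: steps_before_Suc)
  qed
  from this[of "length p"] have "card (?bad (length p)) = 0"
    using sn card K by (simp add: steps_before_length Int_absorb2)
  then have "s q" if "q < length p" "q \<notin> K" "p ! q = North" for q
    using that by auto
  then have "switching_walk p K s"
    unfolding switching_walk_def using s0 sn s_on s_off s_keep s_before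
    by (auto split: if_splits)
  then show ?thesis by blast
qed

section \<open>The matroid of a rational Dyck matrix\<close>

locale dyck_path =
  fixes m d :: nat and p :: "step list"
  assumes d_pos: "d > 0" and m_pos: "m > 0" and dyck: "rational_dyck_path m d p"
begin

lemma counts: "count_list p East = m" "count_list p North = d"
  using dyck by (auto simp: rational_dyck_path_def lattice_point_def)

lemma length_p: "length p = d + m"
  using steps_before_sum[of "length p" p] counts by (simp add: steps_before_length)

lemma below_line: "k \<le> length p \<Longrightarrow> m * steps_before p North k \<le> d * steps_before p East k"
proof -
  assume "k \<le> length p"
  then have "real (steps_before p North k) \<le> real d / real m * real (steps_before p East k)"
    using dyck by (auto simp: rational_dyck_path_def lattice_point_eq)
  then have "real m * real (steps_before p North k) \<le> real d * real (steps_before p East k)"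
    using m_pos by (simp add: field_simps)
  then show ?thesis by (metis of_nat_le_iff of_nat_mult)
qed

lemma first_step: "p ! 0 = East"
proof (rule ccontr)
  assume "p ! 0 \<noteq> East"
  then show False using below_line[of 1] length_p d_pos m_pos by (simp add: steps_before_Suc)
qed

lemma last_step: "p ! (length p - 1) = North"
proof (rule ccontr)
  assume E: "p ! (length p - 1) \<noteq> North"
  let ?k = "length p - 1"
  have k: "Suc ?k = length p" "?k < length p" using length_p d_pos by auto
  have "steps_before p North ?k = d" "Suc (steps_before p East ?k) = m"
    using steps_before_Suc[OF k(2), of North] steps_before_Suc[OF k(2), of East] E k(1)
    by (auto simp: steps_before_length counts)
  then show False using below_line[of ?k] d_pos by (auto simp: mult.commute)
qed

text \<open>The element of the ground set that belongs to step \<open>k\<close>: East steps are numbered along the path after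
the North steps, and these are numbered from top to bottom.\<close>

definition label :: "nat \<Rightarrow> nat" where
  "label k = (if p ! k = East then d + Suc (steps_before p East k) else d - steps_before p North k)"

lemma north_count_less: "k < length p \<Longrightarrow> p ! k = North \<Longrightarrow> steps_before p North k < d"
  using steps_before_less[of k "length p" p North] by (simp add: steps_before_length counts)

lemma east_count_less: "k < length p \<Longrightarrow> p ! k = East \<Longrightarrow> steps_before p East k < m"
  using steps_before_less[of k "length p" p East] by (simp add: steps_before_length counts)

lemma label_le_iff: "k < length p \<Longrightarrow> label k \<le> d \<longleftrightarrow> p ! k = North"
  by (cases "p ! k") (auto simp: label_def)

lemma label_range: "k < length p \<Longrightarrow> label k \<in> {1..d + m}"
  using north_count_less[of k] east_count_less[of k] by (cases "p ! k") (auto simp: label_def)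

lemma inj_label: "inj_on label {..<length p}"
proof (rule inj_onI)
  fix j k assume jk: "j \<in> {..<length p}" "k \<in> {..<length p}" "label j = label k"
  then have same: "p ! j = p ! k" using label_le_iff[of j] label_le_iff[of k] by (cases "p ! j"; cases "p ! k") auto
  then have "steps_before p (p ! j) j = steps_before p (p ! j) k"
    using jk north_count_less[of j] north_count_less[of k] by (cases "p ! j") (auto simp: label_def)
  then show "j = k" using step_pos_unique[of j p "p ! j"] step_pos_unique[of k p "p ! j"] jk same
    by (metis lessThan_iff)
qed

lemma bij_label: "bij_betw label {..<length p} {1..d + m}"
proof -
  have "label ` {..<length p} = {1..d + m}"
    using label_range inj_label by (intro card_subset_eq) (auto simp: card_image length_p)
  then show ?thesis using inj_label by (simp add: bij_betw_def)
qed

lemma label_subsetE: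
  assumes "B \<subseteq> {1..d + m}"
  obtains K where "K \<subseteq> {..<length p}" "B = label ` K"
  using assms bij_label by (metis bij_betw_def subset_image_iff)

definition dyck_matrix :: "real mat" where
  "dyck_matrix = mat d m (\<lambda>(i, j). if Suc i \<le> east_height p (Suc j) then 0 else 1)"

lemma dyck_matrix_entry:
  assumes "i < d" "k < length p" "p ! k = East"
  shows "dyck_matrix $$ (i, steps_before p East k) = of_bool (steps_before p North k \<le> i)"
  using assms east_count_less[of k]
  by (auto simp: dyck_matrix_def east_height_def step_pos_unique lattice_point_eq)

lemma dyck_matrix_in: "dyck_matrix \<in> rational_dyck_matrices d m"
  unfolding rational_dyck_matrices_def using dyck
  by (auto simp: dyck_matrix_def split: if_splits intro!: exI[of _ p])

text \<open>The row \<open>i\<close> of the matrix belongs to the North step preceded by \<open>d - 1 - i\<close> North steps.\<close>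

lemma phi_column:
  assumes "i < d" "k < length p"
  shows "phi d m dyck_matrix $$ (i, label k - 1) =
    (if p ! k = North then of_bool (steps_before p North k = d - 1 - i)
     else (-1) ^ (d - 1 - i) * of_bool (steps_before p North k \<le> d - 1 - i))"
proof (cases "p ! k")
  case East
  then show ?thesis
    using assms east_count_less[of k] dyck_matrix_entry[of "d - 1 - i" k] by (simp add: phi_def label_def)
next
  case North
  have "steps_before p North k < d" using North assms north_count_less by blast
  then show ?thesis
    using assms North by (auto simp: phi_def label_def)
qed

text \<open>The East steps whose column has a nonzero entry in the row of a North step \<open>q\<close> are those that precede \<open>q\<close>,
and their entries there share one sign. Hence row \<open>q\<close> of a linear relation only involves the current at \<open>q\<close>.\<close>

lemma phi_row:
  assumes K: "K \<subseteq> {..<length p}" and q: "q < length p" "p ! q = North"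
    and i: "i = d - 1 - steps_before p North q"
  shows "(\<Sum>b\<in>label ` K. c b * phi d m dyck_matrix $$ (i, b - 1)) =
    (if q \<in> K then c (label q) else 0) + (-1) ^ steps_before p North q * current p K (c \<circ> label) q"
proof -
  let ?y = "steps_before p North"
  have y: "?y q < d" using q north_count_less by blast
  then have id: "i < d" "d - 1 - i = ?y q" using i by auto
  have injK: "inj_on label K" using inj_label K inj_on_subset by blast
  have north: "?y k = ?y q \<longleftrightarrow> k = q" if "k < length p" "p ! k = North" for k
    using that q step_pos_unique by metis
  have east: "?y k \<le> ?y q \<longleftrightarrow> k < q" if "k < length p" "p ! k = East" for k
  proof -
    have "k \<noteq> q" using that q by auto
    then show ?thesis
      using steps_before_mono[of k q p North] steps_before_less[of q k p North] q by (metis less_imp_le not_le nat_neq_iff)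
  qed
  have "(\<Sum>b\<in>label ` K. c b * phi d m dyck_matrix $$ (i, b - 1)) =
      (\<Sum>k\<in>K. c (label k) * phi d m dyck_matrix $$ (i, label k - 1))"
    by (simp add: sum.reindex[OF injK])
  also have "\<dots> = (\<Sum>k\<in>K. (if k = q then c (label k) else 0) +
      (-1) ^ ?y q * (if k < q \<and> p ! k = East then c (label k) else 0))"
  proof (rule sum.cong[OF refl])
    fix k assume "k \<in> K"
    then have k: "k < length p" using K by auto
    show "c (label k) * phi d m dyck_matrix $$ (i, label k - 1) = (if k = q then c (label k) else 0) +
      (-1) ^ ?y q * (if k < q \<and> p ! k = East then c (label k) else 0)"
      using phi_column[OF id(1) k] north[OF k] east[OF k] q id(2) by (cases "p ! k") auto
  qed
  also have "\<dots> = (\<Sum>k\<in>K. if k = q then c (label k) else 0) +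
      (-1) ^ ?y q * (\<Sum>k\<in>K. if k < q \<and> p ! k = East then c (label k) else 0)"
    by (simp add: sum.distrib sum_distrib_left)
  also have "(\<Sum>k\<in>K. if k = q then c (label k) else 0) = (if q \<in> K then c (label q) else 0)"
    using finite_subset[OF K] by (simp add: sum.delta)
  also have "(\<Sum>k\<in>K. if k < q \<and> p ! k = East then c (label k) else 0) = current p K (c \<circ> label) q"
  proof -
    have "(\<Sum>k\<in>K. if k < q \<and> p ! k = East then c (label k) else 0) =
        (\<Sum>k\<in>{..<length p}. if k < q \<and> k \<in> K \<and> p ! k = East then c (label k) else 0)"
      using K by (intro sum.mono_neutral_cong_left) auto
    also have "\<dots> = current p K (c \<circ> label) q"
      unfolding current_def using q by (intro sum.mono_neutral_cong_right) auto
    finally show ?thesis .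
  qed
  finally show ?thesis .
qed

lemma dyck_basis_iff:
  assumes K: "K \<subseteq> {..<length p}"
  shows "columns_form_basis d (phi d m dyck_matrix) (label ` K) \<longleftrightarrow> (\<exists>s. switching_walk p K s)"
proof -
  let ?M = "phi d m dyck_matrix" and ?eps = "\<lambda>q. (-1::real) ^ steps_before p North q"
  have injK: "inj_on label K" using inj_label K inj_on_subset by blast
  have M: "?M \<in> carrier_mat d (d + m)" by (simp add: phi_def)
  have B: "label ` K \<subseteq> {1..d + m}" using K label_range by auto
  have rows: "(\<forall>i<d. (\<Sum>b\<in>label ` K. c b * ?M $$ (i, b - 1)) = 0) \<longleftrightarrow>
      (\<forall>q<length p. p ! q = North \<longrightarrow>
        (if q \<in> K then (c \<circ> label) q else 0) + ?eps q * current p K (c \<circ> label) q = 0)" for c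
  proof (intro iffI allI impI)
    fix q assume *: "\<forall>i<d. (\<Sum>b\<in>label ` K. c b * ?M $$ (i, b - 1)) = 0" and q: "q < length p" "p ! q = North"
    show "(if q \<in> K then (c \<circ> label) q else 0) + ?eps q * current p K (c \<circ> label) q = 0"
      unfolding o_apply phi_row[OF K q refl, of c, symmetric] using * d_pos by simp
  next
    fix i assume *: "\<forall>q<length p. p ! q = North \<longrightarrow>
        (if q \<in> K then (c \<circ> label) q else 0) + ?eps q * current p K (c \<circ> label) q = 0" and i: "i < d"
    obtain q where q: "q < length p" "p ! q = North" "steps_before p North q = d - 1 - i"
      using step_with_count[of "d - 1 - i" p North] counts i by auto
    have "i = d - 1 - steps_before p North q" using q i by auto
    note phi_row[OF K q(1,2) this, of c]
    also have "(if q \<in> K then c (label q) else 0) + ?eps q * current p K (c \<circ> label) q = 0"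
      using * q(1,2) unfolding o_apply by blast
    finally show "(\<Sum>b\<in>label ` K. c b * ?M $$ (i, b - 1)) = 0" .
  qed
  have "(\<forall>c. (\<forall>i<d. (\<Sum>b\<in>label ` K. c b * ?M $$ (i, b - 1)) = 0) \<longrightarrow> (\<forall>b\<in>label ` K. c b = 0)) \<longleftrightarrow>
    independent_steps p ?eps K"
    unfolding rows independent_steps_def
  proof (intro iffI allI impI)
    fix c assume *: "\<forall>c. (\<forall>q<length p. p ! q = North \<longrightarrow>
        (if q \<in> K then (c \<circ> label) q else 0) + ?eps q * current p K (c \<circ> label) q = 0) \<longrightarrow>
        (\<forall>b\<in>label ` K. c b = 0)"
      and c: "\<forall>q<length p. p ! q = North \<longrightarrow> (if q \<in> K then c q else 0) + ?eps q * current p K c q = 0"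
    let ?c = "c \<circ> the_inv_into {..<length p} label"
    have inv: "(?c \<circ> label) k = c k" if "k < length p" for k
      using that inj_label by (simp add: the_inv_into_f_f)
    have cur: "current p K (?c \<circ> label) q = current p K c q" if "q < length p" for q
      unfolding current_def
    proof (rule sum.cong[OF refl])
      fix k assume "k \<in> {..<q}"
      then have "(?c \<circ> label) k = c k" using that by (intro inv) simp
      then show "(if k \<in> K \<and> p ! k = East then (?c \<circ> label) k else 0) = (if k \<in> K \<and> p ! k = East then c k else 0)"
        by (simp only:)
    qed
    have "(if q \<in> K then (?c \<circ> label) q else 0) + ?eps q * current p K (?c \<circ> label) q = 0"
      if "q < length p" "p ! q = North" for q
      unfolding inv[OF that(1)] cur[OF that(1)] using c that by blast
    then have zero: "\<forall>b\<in>label ` K. ?c b = 0" using * by blast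
    show "\<forall>k\<in>K. c k = 0"
    proof
      fix k assume k: "k \<in> K"
      then have "(?c \<circ> label) k = 0" using zero by simp
      moreover have "(?c \<circ> label) k = c k" using k K by (intro inv) auto
      ultimately show "c k = 0" by simp
    qed
  next
    fix c assume *: "\<forall>c. (\<forall>q<length p. p ! q = North \<longrightarrow>
        (if q \<in> K then c q else 0) + ?eps q * current p K c q = 0) \<longrightarrow> (\<forall>k\<in>K. c k = 0)"
      and "\<forall>q<length p. p ! q = North \<longrightarrow>
        (if q \<in> K then (c \<circ> label) q else 0) + ?eps q * current p K (c \<circ> label) q = 0"
    then have "\<forall>k\<in>K. (c \<circ> label) k = 0" by blast
    then show "\<forall>b\<in>label ` K. c b = 0" by simp
  qed
  then have "columns_form_basis d ?M (label ` K) \<longleftrightarrow> card K = count_list p North \<and> independent_steps p ?eps K"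
    using columns_form_basis_iff[OF M B] injK by (simp add: card_image counts)
  also have "\<dots> \<longleftrightarrow> (\<exists>s. switching_walk p K s)"
    using switching_walk_card[OF _ K] switching_walk_independent[OF _ K, of _ ?eps]
      independent_steps_switching_walk[OF _ K, of ?eps] by fastforce
  finally show ?thesis .
qed

lemma column_matroid_dyck:
  "column_matroid d (d + m) (phi d m dyck_matrix) =
    ({1..d + m}, {label ` K | K. K \<subseteq> {..<length p} \<and> (\<exists>s. switching_walk p K s)})"
proof -
  have "B \<subseteq> {1..d + m} \<and> columns_form_basis d (phi d m dyck_matrix) B \<longleftrightarrow>
      (\<exists>K. B = label ` K \<and> K \<subseteq> {..<length p} \<and> (\<exists>s. switching_walk p K s))" for B
  proof (intro iffI; elim conjE exE)
    assume B: "B \<subseteq> {1..d + m}" "columns_form_basis d (phi d m dyck_matrix) B"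
    then obtain K where K: "K \<subseteq> {..<length p}" "B = label ` K" using label_subsetE by metis
    then show "\<exists>K. B = label ` K \<and> K \<subseteq> {..<length p} \<and> (\<exists>s. switching_walk p K s)"
      using B(2) dyck_basis_iff[OF K(1)] by blast
  next
    fix K s assume K: "B = label ` K" "K \<subseteq> {..<length p}" "switching_walk p K s"
    then show "B \<subseteq> {1..d + m} \<and> columns_form_basis d (phi d m dyck_matrix) B"
      using dyck_basis_iff[OF K(2)] label_range by blast
  qed
  then show ?thesis by (auto simp: column_matroid_def)
qed

end

text \<open>The path fixes the positions of the zeros, and the other entries are ones.\<close>

lemma rational_dyck_matrix_cases:
  assumes A: "A \<in> rational_dyck_matrices d m" and pos: "d > 0" "m > 0"
  obtains p where "rational_dyck_path m d p" "A = dyck_path.dyck_matrix m d p"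
proof -
  obtain p where p: "rational_dyck_path m d p"
    and z: "\<And>i j. i \<in> {1..d} \<Longrightarrow> j \<in> {1..m} \<Longrightarrow> A $$ (i - 1, j - 1) = 0 \<longleftrightarrow> i \<le> east_height p j"
    and e: "\<And>i j. i \<in> {1..d} \<Longrightarrow> j \<in> {1..m} \<Longrightarrow> A $$ (i - 1, j - 1) \<in> {0, 1}"
    and C: "A \<in> carrier_mat d m"
    using A by (auto simp: rational_dyck_matrices_def)
  interpret dyck_path m d p using pos p by unfold_locales
  have "A = dyck_matrix"
  proof (rule eq_matI)
    fix i j assume "i < dim_row dyck_matrix" "j < dim_col dyck_matrix"
    then have "i < d" "j < m" by (auto simp: dyck_matrix_def)
    then show "A $$ (i, j) = dyck_matrix $$ (i, j)"
      using z[of "Suc i" "Suc j"] e[of "Suc i" "Suc j"] by (auto simp: dyck_matrix_def)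
  qed (use C in \<open>auto simp: dyck_matrix_def\<close>)
  then show ?thesis using that p by blast
qed

section \<open>The drawing of the plabic graph\<close>

text \<open>A chord perpendicular to a side of length \<open>a\<close> of an inscribed rectangle, through an inner point of that
side, is longer than the other side \<open>b\<close>. Hence the rays leave the rectangle before they reach the circle.\<close>

lemma sqrt_beyond:
  fixes a b x :: real
  assumes "0 < x" "x < a" "0 \<le> b"
  shows "b / 2 < sqrt (a\<^sup>2 / 4 + b\<^sup>2 / 4 - (x - a / 2)\<^sup>2)"
    and "(x - a / 2)\<^sup>2 + (sqrt (a\<^sup>2 / 4 + b\<^sup>2 / 4 - (x - a / 2)\<^sup>2))\<^sup>2 = a\<^sup>2 / 4 + b\<^sup>2 / 4"
proof -
  have "0 < x * (a - x)" using assms by simp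
  then have *: "(b / 2)\<^sup>2 < a\<^sup>2 / 4 + b\<^sup>2 / 4 - (x - a / 2)\<^sup>2"
    by (simp add: power2_eq_square field_simps)
  then show "b / 2 < sqrt (a\<^sup>2 / 4 + b\<^sup>2 / 4 - (x - a / 2)\<^sup>2)" by (rule real_less_rsqrt)
  have "0 \<le> a\<^sup>2 / 4 + b\<^sup>2 / 4 - (x - a / 2)\<^sup>2" using * by (smt (verit) zero_le_power2)
  then show "(x - a / 2)\<^sup>2 + (sqrt (a\<^sup>2 / 4 + b\<^sup>2 / 4 - (x - a / 2)\<^sup>2))\<^sup>2 = a\<^sup>2 / 4 + b\<^sup>2 / 4"
    by simp
qed

lemma linepath_coords:
  "Re (linepath a b t) = Re a + t * (Re b - Re a)" "Im (linepath a b t) = Im a + t * (Im b - Im a)"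
  by (simp_all add: linepath_def algebra_simps)

context dyck_path
begin

abbreviation centre :: complex where "centre \<equiv> Complex (real m / 2) (real d / 2)"
abbreviation radius :: real where "radius \<equiv> cmod (Complex (real m) (real d)) / 2"
abbreviation mid :: "nat \<Rightarrow> complex" where "mid \<equiv> step_mid p"

text \<open>The boundary vertex joined to the midpoint of step \<open>k\<close>, addressed by the step instead of its label.\<close>

definition tip :: "nat \<Rightarrow> complex" where
  "tip k = (if p ! k = East then north_point centre radius (mid k) else east_point centre radius (mid k))"

definition leg :: "nat \<Rightarrow> real \<Rightarrow> complex" where "leg k = linepath (mid k) (tip k)"
definition chain :: "nat \<Rightarrow> real \<Rightarrow> complex" where "chain k = linepath (mid k) (mid (Suc k))"

abbreviation G :: plabic where "G \<equiv> dyck_plabic m d p"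

lemma mid_coords:
  assumes "k < length p"
  shows "Re (mid k) = steps_before p East k + (if p ! k = East then 1 / 2 else 0)"
    and "Im (mid k) = steps_before p North k + (if p ! k = North then 1 / 2 else 0)"
  using assms
  by (auto simp: step_mid_def midpoint_def lattice_point_eq steps_before_Suc field_simps scaleR_complex.sel)

lemma midpoint_centre: "midpoint 0 (Complex (real m) (real d)) = centre"
  by (simp add: midpoint_def complex_eq_iff)

lemma G_simps [simp]:
  "disk_centre G = centre" "disk_radius G = radius" "bdry_count G = d + m"
  "black G = mid ` {k. k < length p \<and> p ! k = North}"
  "white G = mid ` {k. k < length p \<and> p ! k = East}"
  by (simp_all add: dyck_plabic_def Let_def midpoint_centre)

lemma positions_split:
  "{..<length p} = {k. k < length p \<and> p ! k = North} \<union> {k. k < length p \<and> p ! k = East}"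
  by auto

lemma edges_G: "edges G = leg ` {..<length p} \<union> chain ` {k. Suc k < length p}"
proof -
  have N: "(\<lambda>v. linepath v (east_point centre radius v)) ` mid ` {k. k < length p \<and> p ! k = North}
      = leg ` {k. k < length p \<and> p ! k = North}"
    unfolding image_image by (rule image_cong) (auto simp: leg_def tip_def)
  have E: "(\<lambda>v. linepath v (north_point centre radius v)) ` mid ` {k. k < length p \<and> p ! k = East}
      = leg ` {k. k < length p \<and> p ! k = East}"
    unfolding image_image by (rule image_cong) (auto simp: leg_def tip_def)
  have C: "(\<lambda>k. linepath (mid k) (mid (Suc k))) ` {k. Suc k < length p} = chain ` {k. Suc k < length p}"
    by (rule image_cong) (auto simp: chain_def)
  have "edges G = (\<lambda>v. linepath v (east_point centre radius v)) ` mid ` {k. k < length p \<and> p ! k = North}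
      \<union> (\<lambda>v. linepath v (north_point centre radius v)) ` mid ` {k. k < length p \<and> p ! k = East}
      \<union> (\<lambda>k. linepath (mid k) (mid (Suc k))) ` {k. Suc k < length p}"
    by (simp add: dyck_plabic_def Let_def midpoint_centre)
  then show ?thesis unfolding N E C positions_split image_Un .
qed

lemma bdry_label: "k < length p \<Longrightarrow> bdry G (label k) = tip k"
  using label_le_iff[of k] north_count_less[of k] step_pos_unique[of k p North] step_pos_unique[of k p East]
  by (cases "p ! k") (auto simp: dyck_plabic_def Let_def midpoint_centre tip_def label_def Suc_diff_le)

lemma bdry_G: "bdry G ` {1..d + m} = tip ` {..<length p}"
proof -
  have "bdry G ` {1..d + m} = bdry G ` label ` {..<length p}"
    using bij_label by (simp add: bij_betw_def)
  also have "\<dots> = tip ` {..<length p}" using bdry_label by (auto simp: image_image)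
  finally show ?thesis .
qed

lemma interior_G: "black G \<union> white G = mid ` {..<length p}"
  unfolding positions_split image_Un by simp

lemma verts_G: "verts G = tip ` {..<length p} \<union> mid ` {..<length p}"
  using interior_G by (simp only: verts_def G_simps(3) bdry_G Un_assoc)

lemma radius_pos: "radius > 0"
  using d_pos by (simp add: complex_eq_iff)

lemma radius_sq: "radius\<^sup>2 = (real m)\<^sup>2 / 4 + (real d)\<^sup>2 / 4"
  by (simp add: power_divide cmod_power2)

lemma mid_range:
  assumes "k < length p"
  shows "0 \<le> Re (mid k)" "Re (mid k) \<le> m" "0 \<le> Im (mid k)" "Im (mid k) \<le> d"
    "p ! k = East \<Longrightarrow> 0 < Re (mid k)" "p ! k = East \<Longrightarrow> Re (mid k) < m"
    "p ! k = North \<Longrightarrow> 0 < Im (mid k)" "p ! k = North \<Longrightarrow> Im (mid k) < d"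
proof -
  have "steps_before p East k \<le> m" "steps_before p North k \<le> d"
    using steps_before_mono[of k "length p" p] assms counts by (metis less_imp_le steps_before_length)+
  moreover have "p ! k = East \<Longrightarrow> real (steps_before p East k) + 1 \<le> m"
    "p ! k = North \<Longrightarrow> real (steps_before p North k) + 1 \<le> d"
    using east_count_less[of k] north_count_less[of k] assms by linarith+
  ultimately show "0 \<le> Re (mid k)" "Re (mid k) \<le> m" "0 \<le> Im (mid k)" "Im (mid k) \<le> d"
    "p ! k = East \<Longrightarrow> 0 < Re (mid k)" "p ! k = East \<Longrightarrow> Re (mid k) < m"
    "p ! k = North \<Longrightarrow> 0 < Im (mid k)" "p ! k = North \<Longrightarrow> Im (mid k) < d"
    using mid_coords[OF assms] by (cases "p ! k"; simp)+
qed

lemma mid_height_sum: "k < length p \<Longrightarrow> Re (mid k) + Im (mid k) = real k + 1 / 2"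
  using mid_coords[of k] steps_before_sum[of k p] by (cases "p ! k") auto

lemma mid_mono:
  assumes "j \<le> k" "k < length p"
  shows "Re (mid j) \<le> Re (mid k)" "Im (mid j) \<le> Im (mid k)"
    "j < k \<Longrightarrow> p ! j = East \<Longrightarrow> Re (mid j) < Re (mid k)"
    "j < k \<Longrightarrow> p ! j = North \<Longrightarrow> Im (mid j) < Im (mid k)"
proof -
  have j: "j < length p" using assms by simp
  have *: "real (steps_before p s j) + (if p ! j = s then 1 else 0) \<le> real (steps_before p s k)" if "j < k" for s
    using steps_before_mono[of "Suc j" k p s] that j by (auto simp: steps_before_Suc split: if_splits)
  show "Re (mid j) \<le> Re (mid k)" "Im (mid j) \<le> Im (mid k)"
    using assms(1) *[of East] *[of North] mid_coords[OF j] mid_coords[OF assms(2)]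
    by (cases "j = k"; auto split: if_splits)+
  show "j < k \<Longrightarrow> p ! j = East \<Longrightarrow> Re (mid j) < Re (mid k)"
    "j < k \<Longrightarrow> p ! j = North \<Longrightarrow> Im (mid j) < Im (mid k)"
    using *[of East] *[of North] mid_coords[OF j] mid_coords[OF assms(2)]
    by (auto split: if_splits)
qed

text \<open>The circle passes through the origin, so that its equation has no constant term.\<close>

lemma in_disk_iff: "z \<in> ball centre radius \<longleftrightarrow> (Re z)\<^sup>2 + (Im z)\<^sup>2 < m * Re z + d * Im z"
proof -
  have "z \<in> ball centre radius \<longleftrightarrow> cmod (z - centre) < radius"
    by (simp add: dist_norm norm_minus_commute)
  also have "\<dots> \<longleftrightarrow> (cmod (z - centre))\<^sup>2 < radius\<^sup>2"
    using power_mono_iff[of radius "cmod (z - centre)" 2] radius_pos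
    by (meson norm_ge_zero not_le order_less_imp_le pos2)
  also have "\<dots> \<longleftrightarrow> (Re z)\<^sup>2 + (Im z)\<^sup>2 < m * Re z + d * Im z"
  proof -
    have "(x - a / 2)\<^sup>2 = x\<^sup>2 - a * x + a\<^sup>2 / 4" for x a :: real
      by (simp add: power2_eq_square algebra_simps)
    then have "(cmod (z - centre))\<^sup>2 =
        ((Re z)\<^sup>2 - m * Re z + (real m)\<^sup>2 / 4) + ((Im z)\<^sup>2 - d * Im z + (real d)\<^sup>2 / 4)"
      unfolding cmod_power2 by simp
    then show ?thesis unfolding radius_sq by linarith
  qed
  finally show ?thesis .
qed

text \<open>The rectangle with corners \<open>(0,0)\<close> and \<open>(m,d)\<close> is inscribed in the circle, and the midpoint of a step is a
point of the rectangle different from its corners.\<close>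

lemma mid_in_disk:
  assumes "k < length p"
  shows "mid k \<in> ball centre radius"
proof -
  let ?x = "Re (mid k)" and ?y = "Im (mid k)"
  note r = mid_range[OF assms]
  have "0 \<le> ?x * (m - ?x)" "0 \<le> ?y * (d - ?y)" using r by simp_all
  moreover have "p ! k = East \<Longrightarrow> 0 < ?x * (m - ?x)" "p ! k = North \<Longrightarrow> 0 < ?y * (d - ?y)"
    using r by simp_all
  ultimately have "0 < ?x * (m - ?x) + ?y * (d - ?y)" by (cases "p ! k") auto
  then show ?thesis unfolding in_disk_iff by (simp add: power2_eq_square algebra_simps)
qed

lemma tip_coords:
  assumes "k < length p"
  shows "p ! k = East \<Longrightarrow> Re (tip k) = Re (mid k) \<and> Im (mid k) < Im (tip k)"
    "p ! k = North \<Longrightarrow> Im (tip k) = Im (mid k) \<and> Re (mid k) < Re (tip k)"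
    "dist centre (tip k) = radius"
proof -
  note r = mid_range[OF assms]
  note E = sqrt_beyond[of "Re (mid k)" m d] and N = sqrt_beyond[of "Im (mid k)" d m]
  show "p ! k = East \<Longrightarrow> Re (tip k) = Re (mid k) \<and> Im (mid k) < Im (tip k)"
    using r E(1) unfolding tip_def north_point_def radius_sq by simp
  show "p ! k = North \<Longrightarrow> Im (tip k) = Im (mid k) \<and> Re (mid k) < Re (tip k)"
    using r N(1) unfolding tip_def east_point_def radius_sq by (simp add: add.commute)
  have "(dist centre (tip k))\<^sup>2 = radius\<^sup>2"
    using r E(2) N(2)
    unfolding radius_sq dist_norm norm_minus_commute[of centre] cmod_power2 tip_def north_point_def east_point_def
    by (cases "p ! k") (simp_all add: radius_sq add.commute)
  then show "dist centre (tip k) = radius"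
    using radius_pos by (metis less_imp_le power2_eq_imp_eq zero_le_dist)
qed

lemma tip_not_in_disk: "k < length p \<Longrightarrow> tip k \<notin> ball centre radius"
  using tip_coords(3) by simp

lemma open_segment_in_disk:
  assumes "a \<in> ball centre radius" "dist centre b \<le> radius" "0 < t" "t < 1"
  shows "linepath a b t \<in> ball centre radius"
proof -
  have "linepath a b t - centre = (1 - t) *\<^sub>R (a - centre) + t *\<^sub>R (b - centre)"
    by (simp add: linepath_def algebra_simps)
  then have "cmod (linepath a b t - centre) \<le> (1 - t) * cmod (a - centre) + t * cmod (b - centre)"
    using assms norm_triangle_ineq[of "(1 - t) *\<^sub>R (a - centre)" "t *\<^sub>R (b - centre)"] by simp
  also have "\<dots> < (1 - t) * radius + t * radius"
    using assms by (intro add_less_le_mono mult_strict_left_mono mult_left_mono)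
      (auto simp: dist_norm norm_minus_commute)
  also have "\<dots> = ((1 - t) + t) * radius" by (rule distrib_right[symmetric])
  also have "\<dots> = radius" by simp
  finally show ?thesis by (simp add: dist_norm norm_minus_commute)
qed

lemma leg_interior:
  assumes "k < length p" "z \<in> leg k ` {0<..<1}"
  shows "z \<in> ball centre radius" "p ! k = East \<Longrightarrow> Re z = Re (mid k) \<and> Im (mid k) < Im z"
    "p ! k = North \<Longrightarrow> Im z = Im (mid k) \<and> Re (mid k) < Re z"
proof -
  obtain t where t: "0 < t" "t < 1" "z = linepath (mid k) (tip k) t" using assms by (auto simp: leg_def)
  show "z \<in> ball centre radius"
    unfolding t(3) using t tip_coords(3)[OF assms(1)] by (intro open_segment_in_disk mid_in_disk assms) auto
  show "p ! k = East \<Longrightarrow> Re z = Re (mid k) \<and> Im (mid k) < Im z"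
    "p ! k = North \<Longrightarrow> Im z = Im (mid k) \<and> Re (mid k) < Re z"
    unfolding t(3) linepath_coords using t tip_coords[OF assms(1)] by auto
qed

lemma chain_interior:
  assumes "Suc k < length p" "z \<in> chain k ` {0<..<1}"
  shows "z \<in> ball centre radius"
    "Re (mid k) \<le> Re z" "Im (mid k) \<le> Im z" "Re z \<le> Re (mid (Suc k))" "Im z \<le> Im (mid (Suc k))"
    "p ! k = East \<Longrightarrow> Re (mid k) < Re z" "p ! k = North \<Longrightarrow> Im (mid k) < Im z"
    "real k + 1 / 2 < Re z + Im z" "Re z + Im z < real k + 3 / 2"
proof -
  have k: "k < length p" using assms by simp
  obtain t where t: "0 < t" "t < 1" "z = linepath (mid k) (mid (Suc k)) t" using assms by (auto simp: chain_def)
  let ?x = "Re (mid (Suc k)) - Re (mid k)" and ?y = "Im (mid (Suc k)) - Im (mid k)"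
  have zc: "Re z = Re (mid k) + t * ?x" "Im z = Im (mid k) + t * ?y"
    unfolding t(3) linepath_coords by auto
  note mono = mid_mono[of k "Suc k"]
  show "z \<in> ball centre radius"
    unfolding t(3) using t mid_in_disk[OF assms(1)] by (intro open_segment_in_disk mid_in_disk k) auto
  have xy: "0 \<le> ?x" "0 \<le> ?y" using mono assms(1) by auto
  then show "Re (mid k) \<le> Re z" "Im (mid k) \<le> Im z" using t unfolding zc by auto
  have "t * ?x \<le> ?x" "t * ?y \<le> ?y" using xy t by (simp_all add: mult_left_le_one_le)
  then show "Re z \<le> Re (mid (Suc k))" "Im z \<le> Im (mid (Suc k))" unfolding zc by linarith+
  show "p ! k = East \<Longrightarrow> Re (mid k) < Re z" "p ! k = North \<Longrightarrow> Im (mid k) < Im z"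
    using mono assms(1) t unfolding zc by auto
  have "Re z + Im z = Re (mid k) + Im (mid k) + t * (?x + ?y)" unfolding zc by (simp add: algebra_simps)
  also have "?x + ?y = 1"
    using mid_height_sum[OF k] mid_height_sum[OF assms(1)] by simp
  also have "Re (mid k) + Im (mid k) = real k + 1 / 2" by (rule mid_height_sum[OF k])
  finally show "real k + 1 / 2 < Re z + Im z" "Re z + Im z < real k + 3 / 2" using t by auto
qed

lemma inj_mid: "inj_on mid {..<length p}"
proof (rule inj_onI)
  fix j k assume "j \<in> {..<length p}" "k \<in> {..<length p}" "mid j = mid k"
  then have "real j + 1 / 2 = real k + 1 / 2" using mid_height_sum by (metis lessThan_iff)
  then show "j = k" by simp
qed

text \<open>Two legs could only cross if a vertical one started below and to the right of the start of a horizontal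
one, or if two parallel ones were on the same line; midpoints of steps are never placed like this.\<close>

lemma leg_leg_disjoint:
  assumes "j < length p" "k < length p" "z \<in> leg j ` {0<..<1}" "z \<in> leg k ` {0<..<1}"
  shows "j = k"
proof (rule ccontr)
  assume "j \<noteq> k"
  then consider "j < k" | "k < j" by linarith
  then show False
  proof cases
    case 1
    then show False
      using mid_mono[of j k] assms(1,2) leg_interior[OF assms(1,3)] leg_interior[OF assms(2,4)]
      by (cases "p ! j"; cases "p ! k") auto
  next
    case 2
    then show False
      using mid_mono[of k j] assms(1,2) leg_interior[OF assms(1,3)] leg_interior[OF assms(2,4)]
      by (cases "p ! j"; cases "p ! k") auto
  qed
qed

text \<open>The sum of the coordinates is \<open>k + 1/2\<close> at the midpoint of step \<open>k\<close>, so that it separates the segments of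
the chain.\<close>

lemma chain_chain_disjoint:
  assumes "Suc j < length p" "Suc k < length p" "z \<in> chain j ` {0<..<1}" "z \<in> chain k ` {0<..<1}"
  shows "j = k"
proof -
  have "real j < real k + 1" "real k < real j + 1"
    using chain_interior(8,9)[OF assms(1,3)] chain_interior(8,9)[OF assms(2,4)] by auto
  then show ?thesis by linarith
qed

text \<open>A vertical leg runs above the part of the chain before its start and to the left of the part after
it; a horizontal one runs to the right of the former and below the latter.\<close>

lemma leg_chain_disjoint:
  assumes "j < length p" "Suc k < length p" "z \<in> leg j ` {0<..<1}" "z \<in> chain k ` {0<..<1}"
  shows False
proof -
  note l = leg_interior[OF assms(1,3)] and c = chain_interior[OF assms(2,4)]
  consider "k < j" | "k = j" | "j < k" by linarith
  then show False
  proof cases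
    case 1
    then show False using mid_mono(1,2)[of "Suc k" j] assms(1) l c by (cases "p ! j") auto
  next
    case 2
    then show False using l c by (cases "p ! j") auto
  next
    case 3
    then show False using mid_mono[of j k] assms(2) l c by (cases "p ! j") auto
  qed
qed

lemma leg_avoids_verts:
  assumes k: "k < length p" and z: "z \<in> leg k ` {0<..<1}"
  shows "z \<notin> verts G"
proof
  assume "z \<in> verts G"
  then consider j where "j < length p" "z = tip j" | j where "j < length p" "z = mid j"
    unfolding verts_G by auto
  then show False
  proof cases
    case 1
    then show False using leg_interior(1)[OF k z] tip_not_in_disk by blast
  next
    case 2
    then show False
      using leg_interior(2,3)[OF k z] mid_mono[of j k] mid_mono[of k j] k
      by (cases "p ! k"; cases "j < k"; cases "j = k") auto
  qed
qed

lemma chain_avoids_verts: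
  assumes k: "Suc k < length p" and z: "z \<in> chain k ` {0<..<1}"
  shows "z \<notin> verts G"
proof
  assume "z \<in> verts G"
  then consider j where "j < length p" "z = tip j" | j where "j < length p" "z = mid j"
    unfolding verts_G by auto
  then show False
  proof cases
    case 1
    then show False using chain_interior(1)[OF k z] tip_not_in_disk by blast
  next
    case 2
    then have "Re z + Im z = real j + 1 / 2" using mid_height_sum by simp
    then have "real k < real j" "real j < real (Suc k)"
      using chain_interior(8,9)[OF k z] by simp_all
    then show False by simp
  qed
qed

lemma path_ends [simp]:
  "pathstart (leg k) = mid k" "pathfinish (leg k) = tip k"
  "pathstart (chain k) = mid k" "pathfinish (chain k) = mid (Suc k)"
  by (simp_all add: leg_def chain_def)

lemma inj_leg: "inj_on leg {..<length p}"
  using inj_mid by (metis inj_on_def path_ends(1))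

lemma inj_chain: "inj_on chain {k. Suc k < length p}"
proof (rule inj_onI)
  fix j k assume "j \<in> {k. Suc k < length p}" "k \<in> {k. Suc k < length p}" "chain j = chain k"
  then show "j = k" using inj_onD[OF inj_mid, of j k] path_ends(3) by (metis Suc_lessD lessThan_iff mem_Collect_eq)
qed

lemma tip_neq_mid: "j < length p \<Longrightarrow> k < length p \<Longrightarrow> tip j \<noteq> mid k"
  using mid_in_disk tip_not_in_disk by metis

lemma leg_neq_chain: "j < length p \<Longrightarrow> Suc k < length p \<Longrightarrow> leg j \<noteq> chain k"
  using tip_neq_mid[of j "Suc k"] path_ends(2,4) by metis

end

section \<open>The boundary circle\<close>

context dyck_path
begin

text \<open>The North steps have their midpoints at heights \<open>1/2, ..., d - 1/2\<close>, and the East steps at abscissas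
\<open>1/2, ..., m - 1/2\<close>. Their boundary vertices therefore do not depend on the path, and their angles have closed
forms. The shift by a full turn makes the angles of the northern end points follow those of the
eastern ones in clockwise order.\<close>

definition angle :: "nat \<Rightarrow> real" where
  "angle i = (if i \<le> d then arcsin ((real d / 2 - real i + 1 / 2) / radius)
              else arccos ((real (i - d) - 1 / 2 - real m / 2) / radius) - 2 * pi)"

lemma half_sides_le_radius: "real m / 2 < radius" "real d / 2 < radius"
proof -
  have "(real m / 2)\<^sup>2 < radius\<^sup>2" "(real d / 2)\<^sup>2 < radius\<^sup>2"
    using d_pos m_pos unfolding radius_sq by (simp_all add: power2_eq_square)
  then show "real m / 2 < radius" "real d / 2 < radius"
    using radius_pos by (meson less_imp_le power2_less_imp_less)+
qed

text \<open>Both sides are the angle of the corner \<open>(m,d)\<close> seen from the centre. The eastern end points lie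
clockwise after this corner and the northern ones before it.\<close>

lemma corner_angle: "arccos (real m / 2 / radius) = arcsin (real d / 2 / radius)"
proof -
  let ?a = "real m / 2 / radius" and ?b = "real d / 2 / radius"
  have a: "0 \<le> ?a" "?a \<le> 1" using half_sides_le_radius(1) radius_pos by (simp_all add: divide_le_eq)
  have b: "0 \<le> ?b" using radius_pos by simp
  have "?a\<^sup>2 + ?b\<^sup>2 = ((real m)\<^sup>2 / 4 + (real d)\<^sup>2 / 4) / radius\<^sup>2"
    unfolding power_divide[of _ radius] by (simp only: add_divide_distrib) (simp add: power_divide)
  also have "\<dots> = 1" unfolding radius_sq[symmetric] using radius_pos by simp
  finally have "sqrt (1 - ?a\<^sup>2) = ?b" using b by (intro real_sqrt_unique) auto
  then have "sin (arccos ?a) = ?b" using sin_arccos[of ?a] a by linarith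
  moreover have "0 \<le> arccos ?a" "arccos ?a \<le> pi / 2"
    using a arccos_lbound[of ?a] arccos_le_pi2[of ?a] by linarith+
  ultimately show ?thesis using arcsin_sin[of "arccos ?a"] pi_ge_zero by (metis order_trans neg_le_0_iff_le pi_half_ge_zero)
qed

lemma north_arg_bounds:
  assumes "i \<in> {1..d}"
  shows "- 1 < (real d / 2 - real i + 1 / 2) / radius" "(real d / 2 - real i + 1 / 2) / radius < real d / 2 / radius"
    "real d / 2 / radius < 1"
proof -
  have i: "1 \<le> real i" "real i \<le> real d" using assms by auto
  have "- radius < real d / 2 - real i + 1 / 2" using i half_sides_le_radius(2) by linarith
  then show "- 1 < (real d / 2 - real i + 1 / 2) / radius"
    by (simp only: pos_less_divide_eq[OF radius_pos] mult_minus1)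
  show "(real d / 2 - real i + 1 / 2) / radius < real d / 2 / radius"
    using i radius_pos by (intro divide_strict_right_mono) auto
  show "real d / 2 / radius < 1" using half_sides_le_radius(2) divide_less_eq_1_pos[OF radius_pos] by blast
qed

lemma east_arg_bounds:
  assumes "i \<in> {d<..d + m}"
  shows "- 1 < (real (i - d) - 1 / 2 - real m / 2) / radius"
    "(real (i - d) - 1 / 2 - real m / 2) / radius < real m / 2 / radius"
    "real m / 2 / radius < 1"
proof -
  have i: "1 \<le> real (i - d)" "real (i - d) \<le> real m" using assms by auto
  have "- radius < real (i - d) - 1 / 2 - real m / 2" using i half_sides_le_radius(1) by linarith
  then show "- 1 < (real (i - d) - 1 / 2 - real m / 2) / radius"
    by (simp only: pos_less_divide_eq[OF radius_pos] mult_minus1)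
  show "(real (i - d) - 1 / 2 - real m / 2) / radius < real m / 2 / radius"
    using i radius_pos by (intro divide_strict_right_mono) auto
  show "real m / 2 / radius < 1" using half_sides_le_radius(1) divide_less_eq_1_pos[OF radius_pos] by blast
qed

lemma bdry_angle:
  assumes "i \<in> {1..d + m}"
  shows "bdry G i = centre + of_real radius * cis (angle i)"
proof -
  have "i \<in> label ` {..<length p}" using assms bij_label unfolding bij_betw_def by blast
  then obtain k where k: "k < length p" "i = label k" by auto
  have scale: "radius * sqrt (1 - (x / radius)\<^sup>2) = sqrt (radius\<^sup>2 - x\<^sup>2)" for x
  proof -
    have "radius * sqrt (1 - (x / radius)\<^sup>2) = sqrt (radius\<^sup>2 * (1 - (x / radius)\<^sup>2))"
      unfolding real_sqrt_mult using radius_pos by simp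
    also have "radius\<^sup>2 * (1 - (x / radius)\<^sup>2) = radius\<^sup>2 - x\<^sup>2"
    proof -
      have "radius\<^sup>2 * (x / radius)\<^sup>2 = x\<^sup>2"
        unfolding power_divide using radius_pos by simp
      then show ?thesis by (simp only: right_diff_distrib mult_1_right)
    qed
    finally show ?thesis .
  qed
  have cancel: "radius * (x / radius) = x" for x using radius_pos by simp
  show ?thesis
  proof (cases "p ! k")
    case North
    have iN: "i \<in> {1..d}" using assms k label_le_iff[of k] North by auto
    let ?s = "(real d / 2 - real i + 1 / 2) / radius"
    have y: "Im (mid k) = real d / 2 + (real d / 2 - real i + 1 / 2)"
      using k North north_count_less[of k] mid_coords(2)[of k] by (simp add: label_def of_nat_diff)
    have ang: "angle i = arcsin ?s" using iN unfolding angle_def by simp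
    have s: "- 1 \<le> ?s" "?s \<le> 1" using north_arg_bounds[OF iN] by linarith+
    have "bdry G i = east_point centre radius (mid k)"
      unfolding k(2) bdry_label[OF k(1)] tip_def using North by simp
    also have "\<dots> = Complex (real m / 2 + sqrt (radius\<^sup>2 - (real d / 2 - real i + 1 / 2)\<^sup>2))
        (real d / 2 + (real d / 2 - real i + 1 / 2))"
      by (simp only: east_point_def complex.sel y add_diff_cancel_left')
    also have "\<dots> = centre + of_real radius * cis (angle i)"
      unfolding complex_eq_iff ang plus_complex.sel Re_complex_of_real Im_complex_of_real times_complex.sel cis.sel complex.sel
        cos_arcsin[OF s] sin_arcsin[OF s] scale cancel by simp
    finally show ?thesis .
  next
    case East
    have iE: "i \<in> {d<..d + m}" using assms k label_le_iff[of k] East by auto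
    let ?s = "(real (i - d) - 1 / 2 - real m / 2) / radius"
    have x: "Re (mid k) = real m / 2 + (real (i - d) - 1 / 2 - real m / 2)"
      using k East mid_coords(1)[of k] by (simp add: label_def)
    have "angle i = arccos ?s - 2 * pi" using iE unfolding angle_def by simp
    then have ang: "cis (angle i) = cis (arccos ?s)"
      by (simp only: cis_divide[symmetric] cis_2pi div_by_1)
    have s: "- 1 \<le> ?s" "?s \<le> 1" using east_arg_bounds[OF iE] by linarith+
    have "bdry G i = north_point centre radius (mid k)"
      unfolding k(2) bdry_label[OF k(1)] tip_def using East by simp
    also have "\<dots> = Complex (real m / 2 + (real (i - d) - 1 / 2 - real m / 2))
        (real d / 2 + sqrt (radius\<^sup>2 - (real (i - d) - 1 / 2 - real m / 2)\<^sup>2))"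
      by (simp only: north_point_def complex.sel x add_diff_cancel_left')
    also have "\<dots> = centre + of_real radius * cis (angle i)"
      unfolding complex_eq_iff ang plus_complex.sel Re_complex_of_real Im_complex_of_real times_complex.sel cis.sel complex.sel
        cos_arccos[OF s] sin_arccos[OF s] scale cancel by simp
    finally show ?thesis .
  qed
qed

lemma angle_decreasing:
  assumes "i \<in> {1..d + m}" "j \<in> {1..d + m}" "i < j"
  shows "angle j < angle i \<and> angle i < angle j + 2 * pi"
proof -
  let ?n = "\<lambda>i. (real d / 2 - real i + 1 / 2) / radius"
  let ?e = "\<lambda>i. (real (i - d) - 1 / 2 - real m / 2) / radius"
  have ln: "- (pi / 2) \<le> arcsin (?n i) \<and> arcsin (?n i) \<le> pi / 2 \<and> arcsin (?n i) < arcsin (real d / 2 / radius)"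
    if "i \<in> {1..d}" for i
    using north_arg_bounds[OF that] arcsin_bounded[of "?n i"] arcsin_less_mono[of "?n i" "real d / 2 / radius"]
    by auto
  have le: "0 \<le> arccos (?e i) \<and> arccos (?e i) \<le> pi \<and> arccos (real m / 2 / radius) < arccos (?e i)"
    if "i \<in> {d<..d + m}" for i
    using east_arg_bounds[OF that] arccos_bounded[of "?e i"] arccos_less_mono[of "real m / 2 / radius" "?e i"]
    by auto
  consider "j \<le> d" | "i \<le> d" "d < j" | "d < i" by linarith
  then show ?thesis
  proof cases
    case 1
    then have ij: "i \<in> {1..d}" "j \<in> {1..d}" using assms by auto
    have "?n j < ?n i" using assms(3) radius_pos by (intro divide_strict_right_mono) auto
    then have "arcsin (?n j) < arcsin (?n i)"
      using north_arg_bounds[OF ij(1)] north_arg_bounds[OF ij(2)] by (intro arcsin_less_arcsin) linarith+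
    moreover have "angle i = arcsin (?n i)" "angle j = arcsin (?n j)" using ij unfolding angle_def by auto
    ultimately show ?thesis using ln[OF ij(1)] ln[OF ij(2)] pi_gt_zero by linarith
  next
    case 2
    then have ij: "i \<in> {1..d}" "j \<in> {d<..d + m}" using assms by auto
    moreover have "angle i = arcsin (?n i)" "angle j = arccos (?e j) - 2 * pi" using ij unfolding angle_def by auto
    ultimately show ?thesis using ln[OF ij(1)] le[OF ij(2)] pi_gt_zero corner_angle by linarith
  next
    case 3
    then have ij: "i \<in> {d<..d + m}" "j \<in> {d<..d + m}" using assms by auto
    have "?e i < ?e j" using assms(3) 3 radius_pos by (intro divide_strict_right_mono) auto
    then have "arccos (?e j) < arccos (?e i)"
      using east_arg_bounds[OF ij(1)] east_arg_bounds[OF ij(2)] by (intro arccos_less_arccos) linarith+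
    moreover have "angle i = arccos (?e i) - 2 * pi" "angle j = arccos (?e j) - 2 * pi"
      using ij unfolding angle_def by auto
    ultimately show ?thesis using le[OF ij(1)] le[OF ij(2)] pi_gt_zero by linarith
  qed
qed

text \<open>Equal boundary vertices would have angles that differ by a multiple of a full turn, but distinct labels
have distinct angles less than a full turn apart.\<close>

lemma inj_tip: "inj_on tip {..<length p}"
proof (rule inj_onI)
  fix j k assume jk: "j \<in> {..<length p}" "k \<in> {..<length p}" "tip j = tip k"
  have False if "i \<in> {1..d + m}" "i' \<in> {1..d + m}" "i < i'" "bdry G i = bdry G i'" for i i'
  proof -
    have "cis (angle i) = cis (angle i')"
      using that(4) bdry_angle[OF that(1)] bdry_angle[OF that(2)] radius_pos by simp
    then obtain n :: int where n: "angle i = angle i' + 2 * pi * n"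
      using sin_cos_eq_iff[of "angle i" "angle i'"] by (auto simp: complex_eq_iff)
    have "0 < 2 * pi * n" "2 * pi * n < 2 * pi * 1" using angle_decreasing[OF that(1-3)] n by auto
    then have "0 < n" "n < 1" using pi_gt_zero by (simp_all add: zero_less_mult_iff)
    then show False by simp
  qed
  moreover have "bdry G (label j) = bdry G (label k)" using jk bdry_label by simp
  ultimately have "label j = label k" using label_range jk by (metis lessThan_iff linorder_neqE_nat)
  then show "j = k" using inj_label jk by (auto dest: inj_onD)
qed

lemma plabic_graph_G: "plabic_graph G"
proof -
  have fin: "finite (edges G)" unfolding edges_G by (simp add: finite_Collect_less_nat finite_subset[of _ "{..<length p}"] subset_iff)
  have edge_cases: thesis if "e \<in> edges G" "\<And>k. k < length p \<Longrightarrow> e = leg k \<Longrightarrow> thesis"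
    "\<And>k. Suc k < length p \<Longrightarrow> e = chain k \<Longrightarrow> thesis" for e thesis
    using that unfolding edges_G by blast
  have vert: "mid k \<in> verts G" "tip k \<in> verts G" if "k < length p" for k
    using that unfolding verts_G by auto
  have curve: "simple_path e \<and> pathstart e \<in> verts G \<and> pathfinish e \<in> verts G \<and>
      e ` {0<..<1} \<subseteq> ball centre radius - verts G" if "e \<in> edges G" for e
    using that
  proof (rule edge_cases)
    fix k assume k: "k < length p" "e = leg k"
    have "simple_path e" using k tip_neq_mid[of k k] by (auto simp: leg_def intro!: simple_path_linepath)
    then show ?thesis using k vert leg_interior(1) leg_avoids_verts by auto
  next
    fix k assume k: "Suc k < length p" "e = chain k"
    have "mid k \<noteq> mid (Suc k)" using inj_onD[OF inj_mid, of k "Suc k"] k by auto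
    then have "simple_path e" using k by (auto simp: chain_def intro!: simple_path_linepath)
    then show ?thesis using k vert chain_interior(1) chain_avoids_verts by auto
  qed
  have disjoint: "e ` {0<..<1} \<inter> e' ` {0<..<1} = {}" if "e \<in> edges G" "e' \<in> edges G" "e \<noteq> e'" for e e'
  proof (rule ccontr)
    assume "e ` {0<..<1} \<inter> e' ` {0<..<1} \<noteq> {}"
    then obtain z where z: "z \<in> e ` {0<..<1}" "z \<in> e' ` {0<..<1}" by blast
    from that(1) show False
    proof (rule edge_cases)
      fix j assume j: "j < length p" "e = leg j"
      from that(2) show False
      proof (rule edge_cases)
        fix k assume "k < length p" "e' = leg k"
        then show False using leg_leg_disjoint[of j k z] z j that(3) by blast
      next
        fix k assume "Suc k < length p" "e' = chain k"
        then show False using leg_chain_disjoint[of j k z] z j by blast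
      qed
    next
      fix j assume j: "Suc j < length p" "e = chain j"
      from that(2) show False
      proof (rule edge_cases)
        fix k assume "k < length p" "e' = leg k"
        then show False using leg_chain_disjoint[of k j z] z j by blast
      next
        fix k assume "Suc k < length p" "e' = chain k"
        then show False using chain_chain_disjoint[of j k z] z j that(3) by blast
      qed
    qed
  qed
  have leaf: "card {e \<in> edges G. pathstart e = v} + card {e \<in> edges G. pathfinish e = v} = 1"
    if v: "v \<in> bdry G ` {1..d + m}" for v
  proof -
    obtain k where k: "k < length p" "v = tip k" using v unfolding bdry_G by auto
    have "pathstart e \<noteq> v" if "e \<in> edges G" for e
      using that
    proof (rule edge_cases)
      fix j assume "j < length p" "e = leg j"
      then show ?thesis using tip_neq_mid[OF k(1), of j] k(2) by auto
    next
      fix j assume "Suc j < length p" "e = chain j"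
      then show ?thesis using tip_neq_mid[OF k(1), of j] k(2) by auto
    qed
    then have start: "{e \<in> edges G. pathstart e = v} = {}" by blast
    have "e = leg k" if "e \<in> edges G" "pathfinish e = v" for e
      using that(1)
    proof (rule edge_cases)
      fix j assume j: "j < length p" "e = leg j"
      then have "tip j = tip k" using that(2) k(2) by simp
      then have "j = k" using inj_onD[OF inj_tip, of j k] j k by auto
      then show ?thesis using j by simp
    next
      fix j assume "Suc j < length p" "e = chain j"
      then show ?thesis using tip_neq_mid[OF k(1), of "Suc j"] that(2) k(2) by auto
    qed
    moreover have "leg k \<in> edges G" "pathfinish (leg k) = v" using k edges_G by auto
    ultimately have "{e \<in> edges G. pathfinish e = v} = {leg k}" by blast
    then show ?thesis unfolding start by simp
  qed
  have disj: "black G \<inter> white G = {}"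
    using inj_onD[OF inj_mid] by fastforce
  show ?thesis
    unfolding plabic_graph_def G_simps(1-3)
  proof (intro conjI)
    show "0 < radius" by (rule radius_pos)
    show "\<exists>\<theta>. (\<forall>i\<in>{1..d + m}. bdry G i = centre + of_real radius * cis (\<theta> i)) \<and>
        (\<forall>i\<in>{1..d + m}. \<forall>j\<in>{1..d + m}. i < j \<longrightarrow> \<theta> j < \<theta> i \<and> \<theta> i < \<theta> j + 2 * pi)"
      using bdry_angle angle_decreasing by (intro exI[of _ angle]) blast
    show "finite (black G)" "finite (white G)" by simp_all
    show "black G \<union> white G \<subseteq> ball centre radius"
      unfolding interior_G using mid_in_disk by auto
    show "\<forall>e\<in>edges G. \<forall>e'\<in>edges G. e \<noteq> e' \<longrightarrow> e ` {0<..<1} \<inter> e' ` {0<..<1} = {}"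
      using disjoint by blast
    show "\<forall>v\<in>bdry G ` {1..d + m}.
        card {e \<in> edges G. pathstart e = v} + card {e \<in> edges G. pathfinish e = v} = 1"
      using leaf by blast
    show "\<forall>e\<in>edges G. simple_path e \<and> pathstart e \<in> verts G \<and> pathfinish e \<in> verts G \<and>
        e ` {0<..<1} \<subseteq> ball centre radius - verts G"
      using curve by blast
  qed (fact fin disj)+
qed

end

section \<open>Perfect orientations\<close>

lemma card_unique: "card {j. j = (k::'a) \<and> Q} = of_bool Q"
  by (cases Q) auto

lemma card_pred: "card {j. Suc j = k \<and> Q} = of_bool (0 < k \<and> Q)"
proof (cases "0 < k \<and> Q")
  case True
  then have "{j. Suc j = k \<and> Q} = {k - 1}" by auto
  then show ?thesis using True by simp
next
  case False
  then have empty: "{j. Suc j = k \<and> Q} = {}" by auto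
  show ?thesis unfolding empty using False by simp
qed

context dyck_path
begin

text \<open>The edges are directed as prescribed by the set \<open>K\<close> of steps with a source at the boundary and by the bits \<open>s\<close>:
\<open>s (Suc k)\<close> holds if the segment between steps \<open>k\<close> and \<open>Suc k\<close> is directed along the path.\<close>

definition orients :: "orientation \<Rightarrow> nat set \<Rightarrow> (nat \<Rightarrow> bool) \<Rightarrow> bool" where
  "orients \<omega> K s \<longleftrightarrow>
     (\<forall>k<length p. \<omega> (leg k) = (if k \<in> K then (tip k, mid k) else (mid k, tip k))) \<and>
     (\<forall>k. Suc k < length p \<longrightarrow>
        \<omega> (chain k) = (if s (Suc k) then (mid k, mid (Suc k)) else (mid (Suc k), mid k)))"

lemma card_edges_G:
  "card {e \<in> edges G. P e} =
    card {k. k < length p \<and> P (leg k)} + card {k. Suc k < length p \<and> P (chain k)}"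
proof -
  let ?L = "{k. k < length p \<and> P (leg k)}" and ?C = "{k. Suc k < length p \<and> P (chain k)}"
  have "{e \<in> edges G. P e} = leg ` ?L \<union> chain ` ?C" unfolding edges_G by auto
  moreover have "leg ` ?L \<inter> chain ` ?C = {}" using leg_neq_chain by blast
  moreover have "finite ?L" "finite ?C" by (auto intro: finite_subset[of _ "{..<length p}"])
  moreover have "card (leg ` ?L) = card ?L" "card (chain ` ?C) = card ?C"
    using inj_leg inj_chain by (intro card_image; force intro: inj_on_subset)+
  ultimately show ?thesis by (simp add: card_Un_disjoint)
qed

lemma mid_eq_iff: "j < length p \<Longrightarrow> k < length p \<Longrightarrow> mid j = mid k \<longleftrightarrow> j = k"
  using inj_onD[OF inj_mid, of j k] by auto

lemma tip_eq_iff: "j < length p \<Longrightarrow> k < length p \<Longrightarrow> tip j = tip k \<longleftrightarrow> j = k"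
  using inj_onD[OF inj_tip, of j k] by auto

text \<open>The summands belong to the leg, to the next segment of the chain and to the previous one.\<close>

lemma outdeg_mid:
  assumes "orients \<omega> K s" "k < length p"
  shows "outdeg G \<omega> (mid k) =
    of_bool (k \<notin> K) + (of_bool (Suc k < length p \<and> s (Suc k)) + of_bool (0 < k \<and> \<not> s k))"
proof -
  have "fst (\<omega> (leg j)) = mid k \<longleftrightarrow> j = k \<and> k \<notin> K" if "j < length p" for j
  proof -
    have e: "\<omega> (leg j) = (if j \<in> K then (tip j, mid j) else (mid j, tip j))"
      using assms(1) that by (simp add: orients_def)
    show ?thesis
      unfolding e using tip_neq_mid[of j k] mid_eq_iff[of j k] that assms(2) by auto
  qed
  then have 1: "{j. j < length p \<and> fst (\<omega> (leg j)) = mid k} = {j. j = k \<and> k \<notin> K}"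
    using assms(2) by blast
  have "fst (\<omega> (chain j)) = mid k \<longleftrightarrow> j = k \<and> s (Suc k) \<or> Suc j = k \<and> \<not> s k" if "Suc j < length p" for j
  proof -
    have e: "\<omega> (chain j) = (if s (Suc j) then (mid j, mid (Suc j)) else (mid (Suc j), mid j))"
      using assms(1) that by (simp add: orients_def)
    show ?thesis
      unfolding e using mid_eq_iff[of j k] mid_eq_iff[of "Suc j" k] that assms(2) by auto
  qed
  then have 2: "{j. Suc j < length p \<and> fst (\<omega> (chain j)) = mid k} =
      {j. j = k \<and> (Suc k < length p \<and> s (Suc k))} \<union> {j. Suc j = k \<and> \<not> s k}"
    using assms(2) by blast
  have "card ({j. j = k \<and> (Suc k < length p \<and> s (Suc k))} \<union> {j. Suc j = k \<and> \<not> s k}) =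
      card {j. j = k \<and> (Suc k < length p \<and> s (Suc k))} + card {j. Suc j = k \<and> \<not> s k}"
    by (rule card_Un_disjoint) (auto intro: finite_subset[of _ "{..k}"])
  then have "card {j. Suc j < length p \<and> fst (\<omega> (chain j)) = mid k} =
      of_bool (Suc k < length p \<and> s (Suc k)) + of_bool (0 < k \<and> \<not> s k)"
    unfolding 2 card_unique card_pred .
  then show ?thesis unfolding outdeg_def card_edges_G 1 card_unique by simp
qed

lemma indeg_mid:
  assumes "orients \<omega> K s" "k < length p"
  shows "indeg G \<omega> (mid k) =
    of_bool (k \<in> K) + (of_bool (Suc k < length p \<and> \<not> s (Suc k)) + of_bool (0 < k \<and> s k))"
proof -
  have "snd (\<omega> (leg j)) = mid k \<longleftrightarrow> j = k \<and> k \<in> K" if "j < length p" for j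
  proof -
    have e: "\<omega> (leg j) = (if j \<in> K then (tip j, mid j) else (mid j, tip j))"
      using assms(1) that by (simp add: orients_def)
    show ?thesis
      unfolding e using tip_neq_mid[of j k] mid_eq_iff[of j k] that assms(2) by auto
  qed
  then have 1: "{j. j < length p \<and> snd (\<omega> (leg j)) = mid k} = {j. j = k \<and> k \<in> K}"
    using assms(2) by blast
  have "snd (\<omega> (chain j)) = mid k \<longleftrightarrow> j = k \<and> \<not> s (Suc k) \<or> Suc j = k \<and> s k" if "Suc j < length p" for j
  proof -
    have e: "\<omega> (chain j) = (if s (Suc j) then (mid j, mid (Suc j)) else (mid (Suc j), mid j))"
      using assms(1) that by (simp add: orients_def)
    show ?thesis
      unfolding e using mid_eq_iff[of j k] mid_eq_iff[of "Suc j" k] that assms(2) by auto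
  qed
  then have 2: "{j. Suc j < length p \<and> snd (\<omega> (chain j)) = mid k} =
      {j. j = k \<and> (Suc k < length p \<and> \<not> s (Suc k))} \<union> {j. Suc j = k \<and> s k}"
    using assms(2) by blast
  have "card ({j. j = k \<and> (Suc k < length p \<and> \<not> s (Suc k))} \<union> {j. Suc j = k \<and> s k}) =
      card {j. j = k \<and> (Suc k < length p \<and> \<not> s (Suc k))} + card {j. Suc j = k \<and> s k}"
    by (rule card_Un_disjoint) (auto intro: finite_subset[of _ "{..k}"])
  then have "card {j. Suc j < length p \<and> snd (\<omega> (chain j)) = mid k} =
      of_bool (Suc k < length p \<and> \<not> s (Suc k)) + of_bool (0 < k \<and> s k)"
    unfolding 2 card_unique card_pred .
  then show ?thesis unfolding indeg_def card_edges_G 1 card_unique by simp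
qed

lemma indeg_tip:
  assumes "orients \<omega> K s" "k < length p"
  shows "indeg G \<omega> (tip k) = of_bool (k \<notin> K)"
proof -
  have "snd (\<omega> (leg j)) = tip k \<longleftrightarrow> j = k \<and> k \<notin> K" if "j < length p" for j
  proof -
    have e: "\<omega> (leg j) = (if j \<in> K then (tip j, mid j) else (mid j, tip j))"
      using assms(1) that by (simp add: orients_def)
    show ?thesis
      unfolding e using tip_neq_mid[of k j] tip_eq_iff[of j k] that assms(2) by auto
  qed
  then have 1: "{j. j < length p \<and> snd (\<omega> (leg j)) = tip k} = {j. j = k \<and> k \<notin> K}"
    using assms(2) by blast
  have "snd (\<omega> (chain j)) \<noteq> tip k" if "Suc j < length p" for j
  proof -
    have e: "\<omega> (chain j) = (if s (Suc j) then (mid j, mid (Suc j)) else (mid (Suc j), mid j))"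
      using assms(1) that by (simp add: orients_def)
    show ?thesis
      unfolding e using tip_neq_mid[OF assms(2), of j] tip_neq_mid[OF assms(2), of "Suc j"] that by auto
  qed
  then have 2: "{j. Suc j < length p \<and> snd (\<omega> (chain j)) = tip k} = {}" by blast
  show ?thesis unfolding indeg_def card_edges_G 1 2 card_unique by simp
qed

lemma source_set_orients:
  assumes "orients \<omega> K s" "K \<subseteq> {..<length p}"
  shows "source_set G \<omega> = label ` K"
proof -
  have "source_set G \<omega> = {i \<in> label ` {..<length p}. indeg G \<omega> (bdry G i) = 0}"
    using bij_label by (simp add: source_set_def bij_betw_def)
  also have "\<dots> = label ` {k \<in> {..<length p}. indeg G \<omega> (bdry G (label k)) = 0}" by auto
  also have "{k \<in> {..<length p}. indeg G \<omega> (bdry G (label k)) = 0} = K"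
    using assms indeg_tip bdry_label by auto
  finally show ?thesis .
qed

text \<open>The first vertex is white and the last one is black. As the bit is off at both ends, a missing segment
before the first vertex or after the last one behaves like one directed backwards, which adds nothing to the
indegree of the former or to the outdegree of the latter. So the same condition holds at all
vertices: either one segment of the chain enters and the other leaves, or the bit is switched.\<close>

lemma perfect_iff_switching_walk:
  assumes o: "orients \<omega> K s" and io: "is_orientation G \<omega>" and ends: "\<not> s 0" "\<not> s (length p)"
  shows "perfect_orientation G \<omega> \<longleftrightarrow> switching_walk p K s"
proof -
  have right: "(Suc k < length p \<and> s (Suc k)) = s (Suc k)" if "k < length p" for k
    using ends that by (metis Suc_lessI)
  have left: "(0 < k \<and> s k) = s k" for k using ends by (cases k) auto
  have N: "outdeg G \<omega> (mid k) = 1 \<longleftrightarrow> (if k \<notin> K then s k \<and> \<not> s (Suc k) else s (Suc k) = s k)"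
    if "k < length p" "p ! k = North" for k
  proof -
    have "0 < k" using that first_step by (cases k) auto
    then show ?thesis unfolding outdeg_mid[OF o that(1)] right[OF that(1)] by auto
  qed
  have E: "indeg G \<omega> (mid k) = 1 \<longleftrightarrow> (if k \<in> K then \<not> s k \<and> s (Suc k) else s (Suc k) = s k)"
    if "k < length p" "p ! k = East" for k
  proof -
    have "Suc k \<noteq> length p" using that last_step by (metis diff_Suc_1 step.distinct(1))
    then have "Suc k < length p" using that by simp
    then show ?thesis unfolding indeg_mid[OF o that(1)] left by auto
  qed
  have "perfect_orientation G \<omega> \<longleftrightarrow>
      (\<forall>k<length p. (p ! k = North \<longrightarrow> outdeg G \<omega> (mid k) = 1) \<and> (p ! k = East \<longrightarrow> indeg G \<omega> (mid k) = 1))"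
    using io by (auto simp: perfect_orientation_def)
  also have "\<dots> \<longleftrightarrow> (\<forall>k<length p. if (p ! k = East) = (k \<in> K)
      then s k = (p ! k = North) \<and> s (Suc k) = (p ! k = East) else s (Suc k) = s k)"
  proof -
    have "((p ! k = North \<longrightarrow> outdeg G \<omega> (mid k) = 1) \<and> (p ! k = East \<longrightarrow> indeg G \<omega> (mid k) = 1)) \<longleftrightarrow>
      (if (p ! k = East) = (k \<in> K)
       then s k = (p ! k = North) \<and> s (Suc k) = (p ! k = East) else s (Suc k) = s k)"
      if "k < length p" for k
      using N[OF that] E[OF that] by (cases "p ! k") auto
    then show ?thesis by blast
  qed
  also have "\<dots> \<longleftrightarrow> switching_walk p K s" using ends by (simp add: switching_walk_def)
  finally show ?thesis .
qed

lemma orientation_orients: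
  assumes "is_orientation G \<omega>"
  obtains K s where "K \<subseteq> {..<length p}" "orients \<omega> K s" "\<not> s 0" "\<not> s (length p)"
proof
  \<comment> \<open>The bounds on \<open>q\<close> make the bit off at both ends, where no segment determines it.\<close>
  let ?K = "{k. k < length p \<and> \<omega> (leg k) = (tip k, mid k)}"
  let ?s = "\<lambda>q. 0 < q \<and> q < length p \<and> \<omega> (chain (q - 1)) = (mid (q - 1), mid q)"
  show "?K \<subseteq> {..<length p}" by auto
  show "orients \<omega> ?K ?s"
  proof -
    have edge: "\<omega> e = (pathstart e, pathfinish e) \<or> \<omega> e = (pathfinish e, pathstart e)"
      if "e \<in> edges G" for e
      using assms that by (auto simp: is_orientation_def)
    have "\<omega> (leg k) = (mid k, tip k) \<or> \<omega> (leg k) = (tip k, mid k)" if "k < length p" for k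
      using edge[of "leg k"] that edges_G by auto
    moreover have "\<omega> (chain k) = (mid k, mid (Suc k)) \<or> \<omega> (chain k) = (mid (Suc k), mid k)"
      if "Suc k < length p" for k
      using edge[of "chain k"] that edges_G by auto
    ultimately show ?thesis unfolding orients_def by simp blast
  qed
qed auto

lemma exists_orients: "\<exists>\<omega>. is_orientation G \<omega> \<and> orients \<omega> K s"
proof -
  let ?flip = "leg ` {k. k < length p \<and> k \<in> K} \<union> chain ` {k. Suc k < length p \<and> \<not> s (Suc k)}"
  let ?o = "\<lambda>e. if e \<in> ?flip then (pathfinish e, pathstart e) else (pathstart e, pathfinish e)"
  have "leg k \<in> ?flip \<longleftrightarrow> k \<in> K" if "k < length p" for k
    using that leg_neq_chain[OF that] inj_onD[OF inj_leg, of k] by (auto simp: image_iff)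
  moreover have "chain k \<in> ?flip \<longleftrightarrow> \<not> s (Suc k)" if "Suc k < length p" for k
  proof -
    have "chain k \<notin> leg ` {k. k < length p \<and> k \<in> K}" using leg_neq_chain that by (metis (no_types, lifting) imageE mem_Collect_eq)
    then show ?thesis using that inj_onD[OF inj_chain, of k] by (auto simp: image_iff)
  qed
  ultimately have "orients ?o K s" unfolding orients_def by simp
  moreover have "is_orientation G ?o" unfolding is_orientation_def by simp
  ultimately show ?thesis by blast
qed

lemma plabic_matroid_dyck:
  "plabic_matroid G =
    ({1..d + m}, {label ` K | K. K \<subseteq> {..<length p} \<and> (\<exists>s. switching_walk p K s)})"
proof -
  have "(\<exists>\<omega>. B = source_set G \<omega> \<and> perfect_orientation G \<omega>) \<longleftrightarrow>
      (\<exists>K. B = label ` K \<and> K \<subseteq> {..<length p} \<and> (\<exists>s. switching_walk p K s))" for B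
  proof (intro iffI; elim conjE exE)
    fix \<omega> assume w: "B = source_set G \<omega>" "perfect_orientation G \<omega>"
    then have io: "is_orientation G \<omega>" by (simp add: perfect_orientation_def)
    then obtain K s where K: "K \<subseteq> {..<length p}" "orients \<omega> K s" "\<not> s 0" "\<not> s (length p)"
      by (rule orientation_orients)
    then show "\<exists>K. B = label ` K \<and> K \<subseteq> {..<length p} \<and> (\<exists>s. switching_walk p K s)"
      using w source_set_orients[OF K(2,1)] perfect_iff_switching_walk[OF K(2) io K(3,4)] by blast
  next
    fix K s assume K: "B = label ` K" "K \<subseteq> {..<length p}" "switching_walk p K s"
    then have ends: "\<not> s 0" "\<not> s (length p)" by (auto simp: switching_walk_def)
    obtain \<omega> where w: "is_orientation G \<omega>" "orients \<omega> K s" using exists_orients by blast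
    then show "\<exists>\<omega>. B = source_set G \<omega> \<and> perfect_orientation G \<omega>"
      using K source_set_orients[OF w(2) K(2)] perfect_iff_switching_walk[OF w(2,1) ends] by blast
  qed
  then show ?thesis by (auto simp: plabic_matroid_def)
qed

text \<open>If \<open>K\<close> consists of the North steps, then no step switches the bit.\<close>

lemma exists_perfect_orientation: "\<exists>\<omega>. perfect_orientation G \<omega>"
proof -
  let ?K = "{k. k < length p \<and> p ! k = North}" and ?s = "\<lambda>_::nat. False"
  have "switching_walk p ?K ?s" by (auto simp: switching_walk_def)
  moreover obtain \<omega> where w: "is_orientation G \<omega>" "orients \<omega> ?K ?s" using exists_orients by blast
  ultimately show ?thesis using perfect_iff_switching_walk[OF w(2,1)] by blast
qed

text \<open>Both matroids have been described by the switching walks of the path.\<close>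

lemma dyck_plabic_represents_iff:
  "plabic_represents G P \<longleftrightarrow> P = column_matroid d (d + m) (phi d m dyck_matrix)"
  using plabic_graph_G exists_perfect_orientation
  by (simp add: plabic_represents_def plabic_matroid_dyck column_matroid_dyck)

end

theorem theorem6p7:
  fixes d m :: nat and P :: matroid
  assumes "d > 0" and "m > 0" and "positroid d (d + m) P"
  shows "rational_dyck_positroid d m P \<longleftrightarrow>
    (\<exists>p. rational_dyck_path m d p \<and> plabic_represents (dyck_plabic m d p) P)"
proof
  assume "rational_dyck_positroid d m P"
  then obtain A where A: "A \<in> rational_dyck_matrices d m" "P = column_matroid d (d + m) (phi d m A)"
    by (auto simp: rational_dyck_positroid_def)
  obtain p where p: "rational_dyck_path m d p" "A = dyck_path.dyck_matrix m d p"
    using rational_dyck_matrix_cases[OF A(1) assms(1,2)] by blast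
  interpret dyck_path m d p using assms p by unfold_locales
  show "\<exists>p. rational_dyck_path m d p \<and> plabic_represents (dyck_plabic m d p) P"
    using p A dyck_plabic_represents_iff by blast
next
  assume "\<exists>p. rational_dyck_path m d p \<and> plabic_represents (dyck_plabic m d p) P"
  then obtain p where p: "rational_dyck_path m d p" "plabic_represents (dyck_plabic m d p) P" by blast
  interpret dyck_path m d p using assms p by unfold_locales
  show "rational_dyck_positroid d m P"
    using assms(3) p dyck_plabic_represents_iff dyck_matrix_in
    by (auto simp: rational_dyck_positroid_def)
qed

end
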